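(* Let $n \geq 2$ and $k \geq 0$. Let $X$ be the set of D-multidissections of the regular $2n$-gon $\mathbb{P}_{2n}$ with $k$ edges and let the cyclic group $C = \mathbb{Z}_{2n}$ of order $2n$ act on $X$ by D-rotation. Then the triple $(X, C, X(q))$ exhibits the cyclic sieving phenomenon, where $$X(q) = \sum_{\ell = 0}^{\lfloor k/2 \rfloor} s_{(k-\ell,\ell)}(1,q^2,\dots,q^{2(n-1)})\, h_{k-2\ell}(1,q^n).$$
   Context: Cyclic sieving phenomenon (CSP): let $X$ be a finite set, let $C = \langle c \rangle$ be a finite cyclic group acting on $X$ with distinguished generator $c$, and let $X(q) \in \mathbb{N}[q]$. Let $\zeta \in \mathbb{C}$ be a root of unity with the same multiplicative order as $c$ (as an element of the group $C$; here the order is $2n$). The triple $(X,C,X(q))$ exhibits the CSP if for all integers $d \geq 0$ the number of elements of $X$ fixed by $c^d$ equals $X(\zeta^d)$. D-multidissections: an edge of the regular $2n$-gon $\mathbb{P}_{2n}$ is a segment joining two distinct vertices (boundary sides included), and two edges cross in the classical sense if they are distinct and meet at a point interior to both. A D-edge of $\mathbb{P}_{2n}$ is either a pair of centrally symmetric nondiameter edges (which may be boundary edges) or a diameter colored one of two colors, blue or red. Two D-edges cross if (some edge of the one and some edge of the other) cross in the classical sense, except that distinct diameters of the same color do not cross and identical diameters of different colors do not cross; thus two diameters cross exactly when they are distinct diameters of different colors. Let $E_D$ be the set of D-edges, $E_D(CS)$ the set of centrally symmetric pairs of nondiameters, and $E_D(D)$ the set of colored diameters. A D-multidissection is a function $f: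 E_D \to \mathbb{N}=\{0,1,2,\dots\}$ such that whenever $e,e'$ are crossing D-edges, $f(e)=0$ or $f(e')=0$. It has $k$ edges if $\sum_{e \in E_D(CS)} 2f(e) + \sum_{e\in E_D(D)} f(e) = k$ (a centrally symmetric pair of nondiameters counts as two edges, a diameter as one). D-rotation, the action of the distinguished generator of $\mathbb{Z}_{2n}$, is the one-step rotation of $\mathbb{P}_{2n}$ (by angle $2\pi/(2n)$) combined with switching the colors of all diameters. $s_\lambda(x_1,\dots,x_n)$ is the Schur polynomial of $\lambda$ in $n$ variables, where $(k-\ell,0)$ is identified with $(k-\ell)$; $h_m(x_1,\dots,x_n) = \sum_{1 \le i_1 \le \cdots \le i_m \le n} x_{i_1}\cdots x_{i_m}$ is the complete homogeneous symmetric polynomial ($h_0=1$). *)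

theory Defs
  imports
    "HOL-Analysis.Analysis"
    "HOL-Algebra.Group_Action"
    "HOL-Algebra.Elementary_Groups"
    "HOL-Algebra.Multiplicative_Group"
    "HOL-Computational_Algebra.Polynomial"
begin

definition primitive_root_of_unity :: "nat \<Rightarrow> complex \<Rightarrow> bool" where
  "primitive_root_of_unity m \<zeta> \<longleftrightarrow> m > 0 \<and> \<zeta> ^ m = 1 \<and> (\<forall>j. 0 < j \<and> j < m \<longrightarrow> \<zeta> ^ j \<noteq> 1)"

text \<open>
  \<open>G\<close> is the cyclic group, \<open>c\<close> its distinguished generator and \<open>\<phi>\<close> the action on \<open>X\<close>.
  That these data do form an action of a finite cyclic group on a finite set is part of the predicate.
\<close>

definition exhibits_CSP ::
  "'a set \<Rightarrow> ('g, 'b) monoid_scheme \<Rightarrow> 'g \<Rightarrow> ('g \<Rightarrow> 'a \<Rightarrow> 'a) \<Rightarrow> nat poly \<Rightarrow> bool" where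
  "exhibits_CSP X G c \<phi> p \<longleftrightarrow>
     finite X \<and> finite (carrier G) \<and> c \<in> carrier G \<and> generate G {c} = carrier G \<and>
     group_action G X \<phi> \<and>
     (\<forall>\<zeta>. primitive_root_of_unity (group.ord G c) \<zeta> \<longrightarrow>
       (\<forall>d::nat. of_nat (card {x \<in> X. \<phi> (c [^]\<^bsub>G\<^esub> d) x = x}) = poly (map_poly of_nat p) (\<zeta> ^ d)))"

text \<open>The regular polygon with \<open>2 * n\<close> vertices is inscribed in the unit circle of the complex plane.\<close>

definition rot :: "nat \<Rightarrow> complex \<Rightarrow> complex" where
  "rot n z = cis (2 * pi / real (2 * n)) * z"

definition vertices :: "nat \<Rightarrow> complex set" where
  "vertices n = {cis (2 * pi * real i / real (2 * n)) | i. i < 2 * n}"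

definition edges :: "nat \<Rightarrow> complex set set" where
  "edges n = {closed_segment a b | a b. a \<in> vertices n \<and> b \<in> vertices n \<and> a \<noteq> b}"

definition diameters :: "nat \<Rightarrow> complex set set" where
  "diameters n = {closed_segment a (- a) | a. a \<in> vertices n}"

text \<open>The relative interior of a nondegenerate segment is the segment without its end points.\<close>

definition edges_cross :: "complex set \<Rightarrow> complex set \<Rightarrow> bool" where
  "edges_cross e e' \<longleftrightarrow> e \<noteq> e' \<and> rel_interior e \<inter> rel_interior e' \<noteq> {}"

datatype colour = Blue | Red

fun switch :: "colour \<Rightarrow> colour" where
  "switch Blue = Red"
| "switch Red = Blue"

datatype dedge = CSPair "complex set set" | Diam colour "complex set"

definition cs_dedges :: "nat \<Rightarrow> dedge set" where
  "cs_dedges n = {CSPair {e, uminus ` e} | e. e \<in> edges n - diameters n}"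

definition diam_dedges :: "nat \<Rightarrow> dedge set" where
  "diam_dedges n = {Diam col e | col e. e \<in> diameters n}"

definition dedges :: "nat \<Rightarrow> dedge set" where
  "dedges n = cs_dedges n \<union> diam_dedges n"

fun edges_of :: "dedge \<Rightarrow> complex set set" where
  "edges_of (CSPair P) = P"
| "edges_of (Diam col e) = {e}"

definition dedges_cross :: "dedge \<Rightarrow> dedge \<Rightarrow> bool" where
  "dedges_cross D D' \<longleftrightarrow>
     (\<exists>e \<in> edges_of D. \<exists>e' \<in> edges_of D'. edges_cross e e') \<and>
     \<not> (\<exists>col e e'. e \<noteq> e' \<and> D = Diam col e \<and> D' = Diam col e') \<and>
     \<not> (\<exists>col col' e. col \<noteq> col' \<and> D = Diam col e \<and> D' = Diam col' e)"

text \<open>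
  A function on the set of D-edges is represented by its extension by zero to the whole type
  \<^typ>\<open>dedge\<close>, so that equality of functions is equality on D-edges.
\<close>

definition D_multidissections :: "nat \<Rightarrow> nat \<Rightarrow> (dedge \<Rightarrow> nat) set" where
  "D_multidissections n k =
     {f. (\<forall>D. D \<notin> dedges n \<longrightarrow> f D = 0) \<and>
         (\<forall>D \<in> dedges n. \<forall>D' \<in> dedges n. dedges_cross D D' \<longrightarrow> f D = 0 \<or> f D' = 0) \<and>
         (\<Sum>D \<in> cs_dedges n. 2 * f D) + (\<Sum>D \<in> diam_dedges n. f D) = k}"

fun rot_dedge :: "nat \<Rightarrow> dedge \<Rightarrow> dedge" where
  "rot_dedge n (CSPair P) = CSPair ((`) (rot n) ` P)"
| "rot_dedge n (Diam col e) = Diam (switch col) (rot n ` e)"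

text \<open>
  The multiplicity of a D-edge in the rotated multidissection is that of its preimage; note that
  \<^term>\<open>rot_dedge n\<close> is a bijection of the whole type \<^typ>\<open>dedge\<close>.
\<close>

definition D_rotation :: "nat \<Rightarrow> (dedge \<Rightarrow> nat) \<Rightarrow> dedge \<Rightarrow> nat" where
  "D_rotation n f = f \<circ> inv_into UNIV (rot_dedge n)"

text \<open>
  The action of the additive group of integers modulo \<open>2 * n\<close>, with carrier \<open>{0..<2 * n}\<close>, in which
  the generator \<open>1\<close> acts by D-rotation. The restriction is due to the extensionality
  requirement in \<^const>\<open>BijGroup\<close>.
\<close>

definition D_action :: "nat \<Rightarrow> nat \<Rightarrow> int \<Rightarrow> (dedge \<Rightarrow> nat) \<Rightarrow> dedge \<Rightarrow> nat" where
  "D_action n k j = restrict (D_rotation n ^^ nat j) (D_multidissections n k)"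

text \<open>
  Symmetric polynomials are given by their values at a list of elements of a commutative semiring,
  the length of the list being the number of variables. Rows, columns and variables are numbered
  from \<open>0\<close>; a partition may have trailing zero parts.
\<close>

definition cells :: "nat list \<Rightarrow> (nat \<times> nat) set" where
  "cells lam = {(i, j). i < length lam \<and> j < lam ! i}"

definition semistandard_tableaux :: "nat list \<Rightarrow> nat \<Rightarrow> (nat \<times> nat \<Rightarrow> nat) set" where
  "semistandard_tableaux lam n =
     {T \<in> cells lam \<rightarrow>\<^sub>E {..<n}.
        (\<forall>i j j'. j < j' \<and> (i, j) \<in> cells lam \<and> (i, j') \<in> cells lam \<longrightarrow> T (i, j) \<le> T (i, j')) \<and>
        (\<forall>i i' j. i < i' \<and> (i, j) \<in> cells lam \<and> (i', j) \<in> cells lam \<longrightarrow> T (i, j) < T (i', j))}"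

definition schur :: "nat list \<Rightarrow> 'a::comm_semiring_1 list \<Rightarrow> 'a" where
  "schur lam xs = (\<Sum>T \<in> semistandard_tableaux lam (length xs). \<Prod>c \<in> cells lam. xs ! T c)"

definition complete_homogeneous :: "nat \<Rightarrow> 'a::comm_semiring_1 list \<Rightarrow> 'a" where
  "complete_homogeneous m xs =
     (\<Sum>is \<in> {is. length is = m \<and> sorted is \<and> set is \<subseteq> {..<length xs}}. \<Prod>i\<leftarrow>is. xs ! i)"

end

theory Submission
  imports Defs "HOL-Computational_Algebra.Formal_Power_Series"
begin

text \<open>
  Orient every pair of centrally symmetric nondiameters with the centre to the left, and let
  \<open>a i\<close> and \<open>b i\<close> be the numbers of edges of a D-multidissection that leave and enter vertex \<open>i\<close>,
  where a blue diameter leaves and a red diameter enters both of its vertices. By central symmetry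
  \<open>a\<close> and \<open>b\<close> are \<open>n\<close>-periodic, and the number of edges is the sum of \<open>a\<close> and \<open>b\<close> over a period.
  Matching parentheses around the circle shows that every pair of \<open>n\<close>-periodic sequences comes from
  exactly one D-multidissection; unmatched ends become diameters.

  Rotation by \<open>d\<close> steps translates \<open>a\<close> and \<open>b\<close>. So for even \<open>d\<close> the fixed points are given by the
  pairs \<open>(a, b)\<close> that are also \<open>d\<close>-periodic. For odd \<open>d\<close> a fixed point has as many blue as red
  diameters, which by noncrossing forces it to be invariant under switching colours; the fixed
  points then correspond to the \<open>d\<close>-periodic pairs with equal sums.

  On the other side, \<open>s\<^bsub>(k-l,l)\<^esub> = h\<^bsub>k-l\<^esub> h\<^bsub>l\<^esub> - h\<^bsub>k-l+1\<^esub> h\<^bsub>l-1\<^esub>\<close>, and \<open>h\<^bsub>m\<^esub>(1, q\<^sup>n)\<close> at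
  \<open>q = \<zeta>\<^sup>d\<close> is \<open>m + 1\<close> for even \<open>d\<close> and is \<open>1\<close> or \<open>0\<close> according to the parity of \<open>m\<close> for odd \<open>d\<close>.
  So \<open>X(q)\<close> telescopes to the sum of all \<open>h\<^bsub>j\<^esub> h\<^bsub>k-j\<^esub>\<close>, and to \<open>h\<^bsub>k/2\<^esub>\<^sup>2\<close> or \<open>0\<close>, respectively. Finally
  \<open>h\<^bsub>j\<^esub>(1, q\<^sup>2, \<dots>)\<close> is the \<open>j\<close>-th coefficient of \<open>(1 - t\<^sup>r)\<^sup>-\<^sup>g\<close> with \<open>g = gcd n d\<close> and
  \<open>r = n / g\<close>, which counts the sequences with periods \<open>n\<close> and \<open>d\<close> and sum \<open>j\<close>.
\<close>

section \<open>Chords of the regular polygon\<close>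

text \<open>With indices in all of the integers, rotation and central symmetry become the
  translations of the index by \<open>1\<close> and by \<open>n\<close>, and arcs can be described
  by inequalities without reduction modulo \<open>2 * n\<close>.\<close>

definition vertex :: "nat \<Rightarrow> int \<Rightarrow> complex" where
  "vertex n i = cis (pi * of_int i / of_nat n)"

definition chord :: "nat \<Rightarrow> int \<Rightarrow> int \<Rightarrow> complex set" where
  "chord n i j = closed_segment (vertex n i) (vertex n j)"

lemma vertex_eq_iff:
  assumes "n > 0"
  shows "vertex n i = vertex n j \<longleftrightarrow> (\<exists>t. j = i + t * (2 * int n))"
proof -
  have "vertex n i = vertex n j \<longleftrightarrow> (\<exists>t::int. pi * of_int j / of_nat n = pi * of_int i / of_nat n + 2 * pi * of_int t)"
    unfolding vertex_def complex_eq_iff cis.sel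
    by (subst sin_cos_eq_iff[of "pi * of_int j / of_nat n" "pi * of_int i / of_nat n", symmetric]) auto
  also have "\<dots> \<longleftrightarrow> (\<exists>t::int. real_of_int j = of_int i + of_int t * (2 * of_nat n))"
  proof (intro ex_cong1)
    fix t :: int
    have "pi * of_int j / of_nat n = pi * of_int i / of_nat n + 2 * pi * of_int t \<longleftrightarrow>
        pi * of_int j = pi * (of_int i + of_int t * (2 * of_nat n))"
      using assms by (simp add: field_simps)
    then show "pi * of_int j / of_nat n = pi * of_int i / of_nat n + 2 * pi * of_int t \<longleftrightarrow>
        real_of_int j = of_int i + of_int t * (2 * of_nat n)" by simp
  qed
  also have "\<dots> \<longleftrightarrow> (\<exists>t. j = i + t * (2 * int n))"
  proof -
    have "(real_of_int j = of_int i + of_int t * (2 * of_nat n)) = (j = i + t * (2 * int n))" for t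
      using of_int_eq_iff[of j "i + t * (2 * int n)", where 'a = real] by simp
    then show ?thesis by simp
  qed
  finally show ?thesis .
qed

lemma vertex_add_n:
  assumes "n > 0"
  shows "vertex n (i + int n) = - vertex n i"
proof -
  have "pi * of_int (i + int n) / of_nat n = pi * of_int i / of_nat n + pi"
    using assms by (simp add: field_simps)
  then show ?thesis by (simp add: vertex_def complex_eq_iff)
qed

lemma vertex_add_2n: "n > 0 \<Longrightarrow> vertex n (i + t * (2 * int n)) = vertex n i"
  by (rule sym, rule iffD2[OF vertex_eq_iff]) blast+

lemma norm_vertex [simp]: "norm (vertex n i) = 1"
  by (simp add: vertex_def)

lemma rot_vertex: "rot n (vertex n i) = vertex n (i + 1)"
  by (simp add: rot_def vertex_def cis_mult add_divide_distrib distrib_left add.commute)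

text \<open>
  An affine functional vanishing on the line through \<open>cis \<alpha>\<close> and \<open>cis \<beta>\<close>, normalised so that its
  values on the unit circle factor.
\<close>

definition side :: "real \<Rightarrow> real \<Rightarrow> complex \<Rightarrow> real" where
  "side \<alpha> \<beta> z = cos ((\<beta> - \<alpha>) / 2) - Re (z * cis (- (\<alpha> + \<beta>) / 2))"

lemma side_cis: "side \<alpha> \<beta> (cis \<theta>) = 2 * sin ((\<theta> - \<alpha>) / 2) * sin ((\<theta> - \<beta>) / 2)"
proof -
  have "side \<alpha> \<beta> (cis \<theta>) = cos ((\<beta> - \<alpha>) / 2) - cos (\<theta> + - (\<alpha> + \<beta>) / 2)"
    by (simp add: side_def cis_mult)
  also have "\<dots> = 2 * sin ((\<theta> - \<alpha>) / 2) * sin ((\<theta> - \<beta>) / 2)"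
  proof -
    have "((\<beta> - \<alpha>) / 2 + (\<theta> + - (\<alpha> + \<beta>) / 2)) / 2 = (\<theta> - \<alpha>) / 2"
         "(\<theta> + - (\<alpha> + \<beta>) / 2 - (\<beta> - \<alpha>) / 2) / 2 = (\<theta> - \<beta>) / 2"
      by (simp_all add: field_simps)
    then show ?thesis by (simp only: cos_diff_cos)
  qed
  finally show ?thesis .
qed

lemma side_convex:
  "side \<alpha> \<beta> ((1 - u) *\<^sub>R a + u *\<^sub>R b) = (1 - u) * side \<alpha> \<beta> a + u * side \<alpha> \<beta> b"
  by (simp add: side_def algebra_simps)

text \<open>Rotation by \<open>- (\<alpha> + \<beta>) / 2\<close> makes the chord vertical with
  abscissa \<open>cos ((\<beta> - \<alpha>) / 2)\<close>. A point of this line in the open disc has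
  an ordinate smaller in absolute value than the ordinates of the two end points.\<close>

lemma side_eq_0_imp_open_segment:
  assumes "side \<alpha> \<beta> p = 0" "norm p < 1" "0 < \<beta> - \<alpha>" "\<beta> - \<alpha> < 2 * pi"
  shows "p \<in> open_segment (cis \<alpha>) (cis \<beta>)"
proof -
  define c s where "c = cos ((\<beta> - \<alpha>) / 2)" and "s = sin ((\<beta> - \<alpha>) / 2)"
  define w y where "w = p * cis (- (\<alpha> + \<beta>) / 2)" and "y = Im w"
  have s: "s > 0" using assms by (simp add: s_def sin_gt_zero)
  have w: "w = Complex c y"
    using assms(1) by (simp add: side_def c_def w_def y_def complex_eq_iff)
  have "norm w < 1" using assms(2) by (simp add: w_def norm_mult)
  then have "c\<^sup>2 + y\<^sup>2 < 1" by (simp add: w cmod_def)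
  moreover have "c\<^sup>2 + s\<^sup>2 = 1" by (simp add: c_def s_def)
  ultimately have "y\<^sup>2 < s\<^sup>2" by simp
  then have y: "\<bar>y\<bar> < s" using s by (metis abs_of_pos real_sqrt_abs real_sqrt_less_iff)
  \<comment> \<open>The parameter for which the ordinate runs from \<open>- s\<close> at
    \<open>u = 0\<close> to \<open>s\<close> at \<open>u = 1\<close>.\<close>
  define u where "u = (y + s) / (2 * s)"
  have u: "0 < u" "u < 1" using y s by (auto simp: u_def field_simps)
  have ca: "cis \<alpha> = cis ((\<alpha> + \<beta>) / 2) * Complex c (- s)"
  proof -
    have "Complex c (- s) = cis (- (\<beta> - \<alpha>) / 2)"
      unfolding complex_eq_iff c_def s_def cis.sel complex.sel by (simp only: minus_divide_left[symmetric] cos_minus sin_minus)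
    then show ?thesis by (simp add: cis_mult field_simps)
  qed
  have cb: "cis \<beta> = cis ((\<alpha> + \<beta>) / 2) * Complex c s"
  proof -
    have "Complex c s = cis ((\<beta> - \<alpha>) / 2)"
      by (simp add: complex_eq_iff c_def s_def)
    then show ?thesis by (simp add: cis_mult field_simps)
  qed
  have p: "p = cis ((\<alpha> + \<beta>) / 2) * Complex c y"
  proof -
    have "cis (- (\<alpha> + \<beta>) / 2) * cis ((\<alpha> + \<beta>) / 2) = 1"
      by (simp only: cis_mult) (simp add: field_simps)
    then show ?thesis unfolding w[symmetric] w_def by (metis mult.commute mult.left_commute mult.right_neutral)
  qed
  have "Complex c y = (1 - u) *\<^sub>R Complex c (- s) + u *\<^sub>R Complex c s"
    using s by (simp add: complex_eq_iff u_def field_simps)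
  then have "p = (1 - u) *\<^sub>R cis \<alpha> + u *\<^sub>R cis \<beta>"
    unfolding p ca cb by (simp only: distrib_left mult_scaleR_right)
  moreover have "cis \<alpha> \<noteq> cis \<beta>"
    unfolding ca cb mult_cancel_left using s by simp
  ultimately show ?thesis using u unfolding in_segment by blast
qed

text \<open>Strict convexity of the disc: the squared norm of the convex combination is the same
  combination of the squared norms, minus \<open>u * (1 - u)\<close> times the squared distance of
  \<open>a\<close> and \<open>b\<close>.\<close>

lemma norm_convex_less_1:
  fixes a b :: complex
  assumes "norm a = 1" "norm b = 1" "a \<noteq> b" "0 < u" "u < 1"
  shows "norm ((1 - u) *\<^sub>R a + u *\<^sub>R b) < 1"
proof -
  have a: "(Re a)\<^sup>2 + (Im a)\<^sup>2 = 1" and b: "(Re b)\<^sup>2 + (Im b)\<^sup>2 = 1"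
    using assms by (simp_all add: cmod_def)
  have ab: "(Re a - Re b)\<^sup>2 + (Im a - Im b)\<^sup>2 > 0"
    using assms(3) by (simp add: complex_eq_iff sum_power2_gt_zero_iff)
  have "((1 - u) * Re a + u * Re b)\<^sup>2 + ((1 - u) * Im a + u * Im b)\<^sup>2
     = (1 - u) * ((Re a)\<^sup>2 + (Im a)\<^sup>2) + u * ((Re b)\<^sup>2 + (Im b)\<^sup>2)
       - u * (1 - u) * ((Re a - Re b)\<^sup>2 + (Im a - Im b)\<^sup>2)"
    by (simp add: power2_eq_square algebra_simps)
  also have "\<dots> < 1" using ab assms unfolding a b by simp
  finally show ?thesis by (simp add: cmod_def)
qed

section \<open>The two sides of a chord and the crossing criterion\<close>

abbreviation chord_side :: "nat \<Rightarrow> int \<Rightarrow> int \<Rightarrow> complex \<Rightarrow> real" where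
  "chord_side n i j \<equiv> side (pi * of_int i / of_nat n) (pi * of_int j / of_nat n)"

lemma sin_pos_int:
  assumes "0 < x" "x < 2 * int n"
  shows "sin (pi * of_int x / (2 * of_nat n)) > 0"
proof (rule sin_gt_zero)
  show "0 < pi * of_int x / (2 * of_nat n)" using assms by simp
  have "real_of_int x < 2 * of_nat n" using assms by linarith
  then show "pi * of_int x / (2 * of_nat n) < pi" using assms by (simp add: field_simps)
qed

lemma chord_side_vertex:
  "chord_side n i j (vertex n m) =
     2 * sin (pi * of_int (m - i) / (2 * of_nat n)) * sin (pi * of_int (m - j) / (2 * of_nat n))"
proof -
  have "(pi * of_int m / of_nat n - pi * of_int k / of_nat n) / 2 = pi * of_int (m - k) / (2 * of_nat n)" for k
    by (simp add: diff_divide_distrib right_diff_distrib)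
  then show ?thesis by (simp only: vertex_def side_cis)
qed

text \<open>In \<open>chord_side_vertex\<close> the half-angle measured from \<open>i\<close> lies
  between \<open>0\<close> and \<open>pi\<close>, the one measured from \<open>j\<close> between
  \<open>- pi\<close> and \<open>0\<close>, so the sines have opposite signs. Together with
  \<open>chord_side_pos\<close> this puts the two open arcs on opposite sides of the chord.\<close>

lemma chord_side_neg:
  assumes "i < m" "m < j" "j < i + 2 * int n"
  shows "chord_side n i j (vertex n m) < 0"
proof -
  have "sin (pi * of_int (m - i) / (2 * of_nat n)) > 0" "sin (pi * of_int (j - m) / (2 * of_nat n)) > 0"
    using assms by (intro sin_pos_int; simp)+
  moreover have "sin (pi * of_int (m - j) / (2 * of_nat n)) = - sin (pi * of_int (j - m) / (2 * of_nat n))"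
  proof -
    have "pi * of_int (m - j) / (2 * of_nat n) = - (pi * of_int (j - m) / (2 * of_nat n))"
      by (simp add: right_diff_distrib diff_divide_distrib)
    then show ?thesis by (simp only: sin_minus)
  qed
  ultimately show ?thesis by (simp add: chord_side_vertex mult_pos_pos del: of_int_diff)
qed

lemma chord_side_pos:
  assumes "i < j" "j < m" "m < i + 2 * int n"
  shows "chord_side n i j (vertex n m) > 0"
  unfolding chord_side_vertex using assms by (intro mult_pos_pos sin_pos_int) auto

lemma chord_side_ends [simp]:
  "chord_side n i j (vertex n i) = 0" "chord_side n i j (vertex n j) = 0"
  by (simp_all add: chord_side_vertex)

lemma rel_interior_chord:
  "vertex n i \<noteq> vertex n j \<Longrightarrow> rel_interior (chord n i j) = open_segment (vertex n i) (vertex n j)"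
  by (simp add: chord_def rel_interior_closed_segment)

lemma chord_eq_iff:
  "chord n i j = chord n k l \<longleftrightarrow> {vertex n i, vertex n j} = {vertex n k, vertex n l}"
  by (simp add: chord_def)

lemma vertex_neq:
  assumes "i < j" "j < i + 2 * int n"
  shows "vertex n i \<noteq> vertex n j"
proof
  assume "vertex n i = vertex n j"
  moreover have "n > 0" using assms by (cases n) auto
  ultimately obtain t where "j = i + t * (2 * int n)" by (auto simp: vertex_eq_iff)
  then have "0 < t * (2 * int n)" "t * (2 * int n) < 1 * (2 * int n)" using assms by auto
  then have "0 < t" "t < 1"
    using \<open>n > 0\<close> by (simp_all only: zero_less_mult_iff mult_less_cancel_right) auto
  then show False by simp
qed

text \<open>Chooses the index of a vertex in a window starting at a prescribed \<open>i\<close>, so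
  that its position relative to a chord from \<open>i\<close> can be read off from
  inequalities.\<close>

lemma vertex_rep:
  assumes "n > 0"
  obtains m where "vertex n m = vertex n k" "i \<le> m" "m < i + 2 * int n"
proof
  let ?m = "i + (k - i) mod (2 * int n)"
  have "k = ?m + ((k - i) div (2 * int n)) * (2 * int n)"
    using mod_mult_div_eq[of "k - i" "2 * int n"] by (simp add: algebra_simps)
  then show "vertex n ?m = vertex n k" using vertex_eq_iff[OF assms, of ?m k] by blast
qed (use assms in auto)

text \<open>The ends of the second chord lie on opposite sides of the first, so the affine
  functional of the first vanishes at an inner point of the second. This point is in the open disc
  and hence also interior to the first chord.\<close>

lemma edges_cross_chords:
  assumes "i < k" "k < j" "j < l" "l < i + 2 * int n"
  shows "edges_cross (chord n i j) (chord n k l)"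
proof -
  have n: "n > 0" using assms by (cases n) auto
  let ?S = "chord_side n i j"
  have neq: "vertex n i \<noteq> vertex n j" "vertex n k \<noteq> vertex n l" "vertex n i \<noteq> vertex n k"
       "vertex n i \<noteq> vertex n l"
    by (rule vertex_neq; use assms in linarith)+
  have neg: "?S (vertex n k) < 0" and pos: "?S (vertex n l) > 0"
    using assms by (auto intro!: chord_side_neg chord_side_pos)
  \<comment> \<open>The zero of the affine function \<open>?S\<close> along the segment from
    \<open>vertex n k\<close> to \<open>vertex n l\<close>.\<close>
  define u where "u = ?S (vertex n k) / (?S (vertex n k) - ?S (vertex n l))"
  define p where "p = (1 - u) *\<^sub>R vertex n k + u *\<^sub>R vertex n l"
  have u: "0 < u" "u < 1" using neg pos by (auto simp: u_def field_simps)
  have "?S p = 0" using neg pos unfolding p_def side_convex by (simp add: u_def field_simps)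
  moreover have "norm p < 1" unfolding p_def using neq u by (intro norm_convex_less_1) auto
  moreover have "pi * of_int j / of_nat n - pi * of_int i / of_nat n < 2 * pi"
  proof -
    have "real_of_int j < of_int i + 2 * of_nat n" using assms by linarith
    then have "pi * real_of_int j < pi * (of_int i + 2 * of_nat n)" by simp
    then show ?thesis using n by (simp add: field_simps)
  qed
  moreover have "0 < pi * of_int j / of_nat n - pi * of_int i / of_nat n"
    using assms n by (simp add: field_simps)
  ultimately have "p \<in> open_segment (vertex n i) (vertex n j)"
    unfolding vertex_def by (intro side_eq_0_imp_open_segment)
  moreover have "p \<in> open_segment (vertex n k) (vertex n l)"
    unfolding in_segment p_def using neq u by blast
  moreover have "chord n i j \<noteq> chord n k l" using neq by (auto simp: chord_eq_iff doubleton_eq_iff)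
  ultimately show ?thesis using neq by (auto simp: edges_cross_def rel_interior_chord)
qed

text \<open>Otherwise the functional of the first chord is nonnegative at both ends of the second.
  Its vanishing at a common inner point then makes it vanish at both ends, which are therefore
  \<open>i\<close> and \<open>j\<close>, so that the chords coincide.\<close>

lemma edges_cross_imp_inner_end:
  assumes "edges_cross (chord n i j) (chord n k l)" "i < j" "j < i + 2 * int n"
      "vertex n k \<noteq> vertex n l"
  shows "\<exists>m. i < m \<and> m < j \<and> (vertex n m = vertex n k \<or> vertex n m = vertex n l)"
proof (rule ccontr)
  assume *: "\<not> ?thesis"
  have n: "n > 0" using assms by (cases n) auto
  have ij: "vertex n i \<noteq> vertex n j" using assms by (intro vertex_neq)
  let ?S = "chord_side n i j"
  obtain k' where k': "vertex n k' = vertex n k" "i \<le> k'" "k' < i + 2 * int n"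
    using n by (rule vertex_rep)
  obtain l' where l': "vertex n l' = vertex n l" "i \<le> l'" "l' < i + 2 * int n"
    using n by (rule vertex_rep)
  have nn: "(m = i \<or> m = j) \<or> ?S (vertex n m) > 0" "?S (vertex n m) \<ge> 0"
    if "m = k' \<or> m = l'" for m
  proof -
    have "i \<le> m" "m < i + 2 * int n" "\<not> (i < m \<and> m < j)"
      using that k' l' * by auto
    then have "(m = i \<or> m = j) \<or> (j < m \<and> m < i + 2 * int n)" by linarith
    then show "(m = i \<or> m = j) \<or> ?S (vertex n m) > 0" using chord_side_pos assms(2) by blast
    then show "?S (vertex n m) \<ge> 0" by auto
  qed
  obtain p where p: "p \<in> open_segment (vertex n i) (vertex n j)" "p \<in> open_segment (vertex n k) (vertex n l)"
    using assms ij by (auto simp: edges_cross_def rel_interior_chord)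
  have "?S p = 0" using p(1) by (auto simp: in_segment side_convex)
  moreover obtain u where u: "0 < u" "u < 1" "p = (1 - u) *\<^sub>R vertex n k + u *\<^sub>R vertex n l"
    using p(2) by (auto simp: in_segment)
  ultimately have "(1 - u) * ?S (vertex n k') + u * ?S (vertex n l') = 0"
    by (simp add: side_convex k' l')
  moreover have "(1 - u) * ?S (vertex n k') \<ge> 0" "u * ?S (vertex n l') \<ge> 0"
    using nn(2)[of k'] nn(2)[of l'] u by auto
  ultimately have "(1 - u) * ?S (vertex n k') = 0" "u * ?S (vertex n l') = 0" by linarith+
  then have "?S (vertex n k') = 0" "?S (vertex n l') = 0" using u by auto
  then have "k' = i \<or> k' = j" "l' = i \<or> l' = j" using nn(1)[of k'] nn(1)[of l'] by auto
  then have "chord n i j = chord n k l" using assms(4) k' l' by (auto simp: chord_eq_iff)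
  then show False using assms(1) by (simp add: edges_cross_def)
qed

section \<open>D-edges\<close>

lemma vertices_eq: "n > 0 \<Longrightarrow> vertices n = range (vertex n)"
proof (intro equalityI subsetI)
  fix z assume "z \<in> vertices n"
  then obtain i where "z = cis (2 * pi * real i / real (2 * n))" by (auto simp: vertices_def)
  then have "z = vertex n (int i)" by (simp add: vertex_def)
  then show "z \<in> range (vertex n)" by simp
next
  fix z assume n: "n > 0" and "z \<in> range (vertex n)"
  then obtain k where k: "z = vertex n k" by auto
  obtain m where m: "vertex n m = vertex n k" "0 \<le> m" "m < 0 + 2 * int n"
    using n by (rule vertex_rep)
  then have "z = cis (2 * pi * real (nat m) / real (2 * n))" "nat m < 2 * n"
    using k by (auto simp: vertex_def)
  then show "z \<in> vertices n" by (auto simp: vertices_def)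
qed

lemma vertex_add_mult_n:
  assumes "n > 0"
  shows "vertex n (i + t * int n) = (if even t then vertex n i else - vertex n i)"
proof (cases "even t")
  case True
  then obtain s where "t = 2 * s" by (elim evenE)
  then have "i + t * int n = i + s * (2 * int n)" by simp
  then show ?thesis using True assms by (simp only: vertex_add_2n) simp
next
  case False
  then obtain s where "t = 2 * s + 1" by (elim oddE)
  then have "i + t * int n = (i + int n) + s * (2 * int n)" by (simp add: algebra_simps)
  then show ?thesis using False assms by (simp only: vertex_add_2n vertex_add_n) simp
qed

lemma vertex_eq_imp_mod: "n > 0 \<Longrightarrow> vertex n i = vertex n j \<Longrightarrow> i mod int n = j mod int n"
  by (auto simp: vertex_eq_iff simp flip: mult.assoc)

lemma mod_eq_imp_shift: "i mod int n = m mod int n \<Longrightarrow> \<exists>t. m = i + t * int n"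
  using mod_eq_dvd_iff[of m "int n" i] by (auto simp: dvd_def algebra_simps)

lemma diameters_eq:
  assumes "n > 0"
  shows "diameters n = {chord n i (i + int n) | i. True}"
  unfolding diameters_def vertices_eq[OF assms] chord_def vertex_add_n[OF assms] by auto

lemma edges_diff_diameters_eq:
  assumes n: "n > 0"
  shows "edges n - diameters n = {chord n i j | i j. i < j \<and> j < i + int n}"
proof (intro equalityI subsetI)
  fix e assume e: "e \<in> edges n - diameters n"
  then obtain i k where i: "e = chord n i k" "vertex n i \<noteq> vertex n k"
    using n by (auto simp: edges_def chord_def vertices_eq)
  obtain j where j: "vertex n j = vertex n k" "i \<le> j" "j < i + 2 * int n"
    using n by (rule vertex_rep)
  have e_ij: "e = chord n i j" using i j by (simp add: chord_def)
  have "j \<noteq> i" "j \<noteq> i + int n" using i j e e_ij n by (auto simp: diameters_eq)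
  then consider "i < j" "j < i + int n" | "i + int n < j" using j by linarith
  then show "e \<in> {chord n i j | i j. i < j \<and> j < i + int n}"
  proof cases
    case 1 then show ?thesis using e_ij by auto
  next
    case 2
    \<comment> \<open>The arc from \<open>i\<close> to \<open>j\<close> is longer than
      \<open>n\<close> steps, so the complementary arc from \<open>j\<close> to
      \<open>i + 2 * n\<close> is used.\<close>
    have "e = chord n j (i + 1 * (2 * int n))"
      unfolding e_ij by (simp only: chord_eq_iff vertex_add_2n[OF n] insert_commute)
    then show ?thesis using 2 j by fastforce
  qed
next
  fix e assume "e \<in> {chord n i j | i j. i < j \<and> j < i + int n}"
  then obtain i j where ij: "e = chord n i j" "i < j" "j < i + int n" by auto
  have "vertex n i \<noteq> vertex n j" using ij by (intro vertex_neq) auto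
  then have "e \<in> edges n" using n ij by (auto simp: edges_def chord_def vertices_eq)
  moreover have "e \<notin> diameters n"
  proof
    assume "e \<in> diameters n"
    then obtain k where "e = chord n k (k + int n)" using n by (auto simp: diameters_eq)
    then have "vertex n i = - vertex n j"
      using ij n by (auto simp: chord_eq_iff doubleton_eq_iff vertex_add_n)
    then have "vertex n (i + int n) = vertex n j" using n by (simp add: vertex_add_n)
    moreover have "vertex n j \<noteq> vertex n (i + int n)" using ij by (intro vertex_neq) auto
    ultimately show False by simp
  qed
  ultimately show "e \<in> edges n - diameters n" by simp
qed

lemma uminus_chord: "n > 0 \<Longrightarrow> uminus ` chord n i j = chord n (i + int n) (j + int n)"
  unfolding chord_def vertex_add_n
  by (rule closed_segment_linear_image[symmetric]) (rule linear_uminus)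

lemma rot_chord: "rot n ` chord n i j = chord n (i + 1) (j + 1)"
proof -
  have "linear (rot n)" unfolding rot_def by (rule linear_times)
  then show ?thesis unfolding chord_def rot_vertex[symmetric]
    by (rule closed_segment_linear_image[symmetric])
qed

definition cs_pair :: "nat \<Rightarrow> int \<Rightarrow> int \<Rightarrow> dedge" where
  "cs_pair n i j = CSPair {chord n i j, chord n (i + int n) (j + int n)}"

definition diam :: "nat \<Rightarrow> colour \<Rightarrow> int \<Rightarrow> dedge" where
  "diam n col i = Diam col (chord n i (i + int n))"

lemma cs_dedges_eq:
  assumes "n > 0"
  shows "cs_dedges n = {cs_pair n i j | i j. i < j \<and> j < i + int n}"
proof -
  have "cs_pair n i j = CSPair {chord n i j, uminus ` chord n i j}" for i j
    by (simp add: cs_pair_def uminus_chord[OF assms])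
  then show ?thesis
    unfolding cs_dedges_def edges_diff_diameters_eq[OF assms] by (simp only:) blast
qed

lemma diam_dedges_eq: "n > 0 \<Longrightarrow> diam_dedges n = {diam n col i | col i. True}"
  by (auto simp: diam_dedges_def diameters_eq diam_def)

lemma dedges_cases:
  assumes "n > 0" "D \<in> dedges n"
  obtains (pair) i j where "D = cs_pair n i j" "i < j" "j < i + int n"
    | (diam) col i where "D = diam n col i"
  using assms by (auto simp: dedges_def cs_dedges_eq diam_dedges_eq)

lemma cs_pair_in_dedges: "n > 0 \<Longrightarrow> i < j \<Longrightarrow> j < i + int n \<Longrightarrow> cs_pair n i j \<in> dedges n"
  by (auto simp: dedges_def cs_dedges_eq)

lemma diam_in_dedges: "n > 0 \<Longrightarrow> diam n col i \<in> dedges n"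
  by (auto simp: dedges_def diam_dedges_eq)

lemma cs_pair_neq_diam [simp]: "cs_pair n i j \<noteq> diam n col k" "diam n col k \<noteq> cs_pair n i j"
  by (simp_all add: cs_pair_def diam_def)

lemma diam_eq_iff:
  assumes n: "n > 0"
  shows "diam n col i = diam n col' k \<longleftrightarrow> col = col' \<and> i mod int n = k mod int n"
proof -
  have "{vertex n i, vertex n (i + int n)} = {vertex n k, vertex n (k + int n)} \<longleftrightarrow> i mod int n = k mod int n"
  proof
    assume "{vertex n i, vertex n (i + int n)} = {vertex n k, vertex n (k + int n)}"
    then have "vertex n i = vertex n k \<or> vertex n i = vertex n (k + int n)" by blast
    then have "i mod int n = k mod int n \<or> i mod int n = (k + int n) mod int n"
      using vertex_eq_imp_mod[OF n] by blast
    then show "i mod int n = k mod int n" by simp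
  next
    assume "i mod int n = k mod int n"
    then obtain t where t: "k = i + t * int n" using mod_eq_imp_shift by blast
    then have "vertex n k = vertex n i \<or> vertex n k = - vertex n i"
      using vertex_add_mult_n[OF n] by simp
    then show "{vertex n i, vertex n (i + int n)} = {vertex n k, vertex n (k + int n)}"
      by (elim disjE) (simp_all add: vertex_add_n[OF n] insert_commute)
  qed
  then show ?thesis by (simp add: diam_def chord_eq_iff)
qed

lemma cs_pair_shift:
  assumes n: "n > 0"
  shows "cs_pair n (i + t * int n) (j + t * int n) = cs_pair n i j"
  by (simp add: cs_pair_def chord_def vertex_add_n[OF n] vertex_add_mult_n[OF n] insert_commute)

text \<open>Both arcs are shorter than \<open>n\<close>. If the ends were interchanged, the arc
  lengths would add up to a multiple of \<open>2 * n\<close>, which is impossible for a sum strictly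
  between \<open>0\<close> and \<open>2 * n\<close>; if they agree in order, equal arc lengths force
  equal shifts. The shift is expressed in units of \<open>n\<close> to suit
  \<open>cs_pair_eqD\<close>, where central symmetry shifts by \<open>n\<close>.\<close>

lemma chord_eqD:
  assumes n: "n > 0" and "i < j" "j < i + int n" "k < l" "l < k + int n"
    and eq: "chord n i j = chord n k l"
  shows "\<exists>t. k = i + t * int n \<and> l = j + t * int n"
proof -
  have *: "x \<noteq> t * (2 * int n)" if "0 < x" "x < 2 * int n" for x t
  proof
    assume x: "x = t * (2 * int n)"
    then have "t > 0" using that(1) n by (auto simp: zero_less_mult_iff)
    then have "1 * (2 * int n) \<le> t * (2 * int n)" by (intro mult_right_mono) auto
    then show False using that(2) x by simp
  qed
  from eq consider "vertex n i = vertex n k" "vertex n j = vertex n l"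
    | "vertex n i = vertex n l" "vertex n j = vertex n k"
    by (auto simp: chord_eq_iff doubleton_eq_iff)
  then show ?thesis
  proof cases
    case 1
    then obtain s t where st: "k = i + s * (2 * int n)" "l = j + t * (2 * int n)"
      using n by (auto simp: vertex_eq_iff)
    have "(l - k) - (j - i) = (t - s) * (2 * int n)" "(j - i) - (l - k) = (s - t) * (2 * int n)"
      using st by (simp_all add: algebra_simps)
    then have "\<not> 0 < (l - k) - (j - i)" "\<not> 0 < (j - i) - (l - k)"
      using *[of "(l - k) - (j - i)" "t - s"] *[of "(j - i) - (l - k)" "s - t"] assms by linarith+
    then have "(t - s) * (2 * int n) = 0" using \<open>(l - k) - (j - i) = _\<close> by linarith
    then have "s = t" using n by simp
    then show ?thesis using st by (intro exI[of _ "2 * s"]) simp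
  next
    case 2
    then obtain s t where st: "l = i + s * (2 * int n)" "k = j + t * (2 * int n)"
      using n by (auto simp: vertex_eq_iff)
    then have "(l - k) + (j - i) = (s - t) * (2 * int n)" by (simp add: algebra_simps)
    then show ?thesis using *[of "(l - k) + (j - i)" "s - t"] assms by linarith
  qed
qed

lemma cs_pair_eqD:
  assumes "n > 0" "i < j" "j < i + int n" "k < l" "l < k + int n"
    and eq: "cs_pair n i j = cs_pair n k l"
  shows "\<exists>t. k = i + t * int n \<and> l = j + t * int n"
proof -
  have "chord n k l = chord n i j \<or> chord n k l = chord n (i + int n) (j + int n)"
    using eq by (auto simp: cs_pair_def)
  then show ?thesis
  proof
    assume "chord n k l = chord n i j"
    then show ?thesis using chord_eqD[of n i j k l] assms by simp
  next
    assume "chord n k l = chord n (i + int n) (j + int n)"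
    then obtain t where "k = i + int n + t * int n \<and> l = j + int n + t * int n"
      using chord_eqD[of n "i + int n" "j + int n" k l] assms by auto
    then show ?thesis by (intro exI[of _ "t + 1"]) (simp add: algebra_simps)
  qed
qed

text \<open>
  A pair of centrally symmetric edges is oriented so that the centre lies to the left; a blue
  diameter consists of two outgoing ends, a red one of two incoming ends.
\<close>

definition starts :: "nat \<Rightarrow> dedge \<Rightarrow> int \<Rightarrow> bool" where
  "starts n D m \<longleftrightarrow> (\<exists>j. m < j \<and> j < m + int n \<and> D = cs_pair n m j) \<or> D = diam n Blue m"

definition ends :: "nat \<Rightarrow> dedge \<Rightarrow> int \<Rightarrow> bool" where
  "ends n D m \<longleftrightarrow> (\<exists>i. i < m \<and> m < i + int n \<and> D = cs_pair n i m) \<or> D = diam n Red m"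

lemma starts_cs_pair:
  assumes "n > 0" "i < j" "j < i + int n"
  shows "starts n (cs_pair n i j) m \<longleftrightarrow> i mod int n = m mod int n"
proof
  assume "starts n (cs_pair n i j) m"
  then obtain l where "m < l" "l < m + int n" "cs_pair n i j = cs_pair n m l"
    by (auto simp: starts_def)
  then show "i mod int n = m mod int n" using cs_pair_eqD[OF assms] by fastforce
next
  assume "i mod int n = m mod int n"
  then obtain t where "m = i + t * int n" using mod_eq_imp_shift by blast
  then show "starts n (cs_pair n i j) m"
    unfolding starts_def using assms cs_pair_shift[OF assms(1), of i t j]
    by (intro disjI1 exI[of _ "j + t * int n"]) auto
qed

lemma ends_cs_pair:
  assumes "n > 0" "i < j" "j < i + int n"
  shows "ends n (cs_pair n i j) m \<longleftrightarrow> j mod int n = m mod int n"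
proof
  assume "ends n (cs_pair n i j) m"
  then obtain l where "l < m" "m < l + int n" "cs_pair n i j = cs_pair n l m"
    by (auto simp: ends_def)
  then show "j mod int n = m mod int n" using cs_pair_eqD[OF assms] by fastforce
next
  assume "j mod int n = m mod int n"
  then obtain t where "m = j + t * int n" using mod_eq_imp_shift by blast
  then show "ends n (cs_pair n i j) m"
    unfolding ends_def using assms cs_pair_shift[OF assms(1), of i t j]
    by (intro disjI1 exI[of _ "i + t * int n"]) auto
qed

lemma starts_diam: "n > 0 \<Longrightarrow> starts n (diam n col i) m \<longleftrightarrow> col = Blue \<and> i mod int n = m mod int n"
  by (auto simp: starts_def diam_eq_iff)

lemma ends_diam: "n > 0 \<Longrightarrow> ends n (diam n col i) m \<longleftrightarrow> col = Red \<and> i mod int n = m mod int n"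
  by (auto simp: ends_def diam_eq_iff)

lemmas ends_simps = starts_cs_pair ends_cs_pair starts_diam ends_diam

section \<open>Crossing of D-edges in terms of their ends\<close>

lemma dedges_cross_sym:
  assumes "dedges_cross D D'"
  shows "dedges_cross D' D"
proof -
  obtain e e' where "e \<in> edges_of D" "e' \<in> edges_of D'" "edges_cross e e'"
    using assms by (auto simp: dedges_cross_def)
  moreover from this have "edges_cross e' e" by (auto simp: edges_cross_def)
  ultimately have "\<exists>e \<in> edges_of D'. \<exists>e' \<in> edges_of D. edges_cross e e'" by blast
  moreover have "\<not> (\<exists>col e e'. e \<noteq> e' \<and> D' = Diam col e \<and> D = Diam col e')"
    using assms by (cases D; cases D'; simp add: dedges_cross_def; (elim conjE disjE; simp)?)
  moreover have "\<not> (\<exists>col col' e. col \<noteq> col' \<and> D' = Diam col e \<and> D = Diam col' e)"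
    using assms by (cases D; cases D'; simp add: dedges_cross_def; (elim conjE disjE; simp)?)
  ultimately show ?thesis unfolding dedges_cross_def by (intro conjI)
qed

lemma edges_of_dedge:
  "edges_of (cs_pair n i j) = {chord n i j, chord n (i + int n) (j + int n)}"
  "edges_of (diam n col i) = {chord n i (i + int n)}"
  by (simp_all add: cs_pair_def diam_def)

lemma cs_pairs_cross:
  assumes "k < i" "i < j" "j < l" "l < k + 2 * int n"
  shows "dedges_cross (cs_pair n k j) (cs_pair n i l)"
proof -
  have "edges_cross (chord n k j) (chord n i l)"
    using assms by (intro edges_cross_chords)
  then show ?thesis by (simp add: dedges_cross_def cs_pair_def)
qed

lemma cs_pair_cross_diam:
  assumes "i < j" "j < l" "l < i + int n"
  shows "dedges_cross (cs_pair n i l) (diam n col j)"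
proof -
  have "edges_cross (chord n i l) (chord n j (j + int n))"
    using assms by (intro edges_cross_chords) auto
  then show ?thesis by (simp add: dedges_cross_def cs_pair_def diam_def)
qed

text \<open>Distinct diameters always cross as edges, so beyond coincidence only the colours matter.
  To apply \<open>edges_cross_chords\<close>, one end of the second diameter is placed strictly
  between \<open>i\<close> and \<open>i + n\<close>.\<close>

lemma dedges_cross_diams:
  assumes n: "n > 0"
  shows "dedges_cross (diam n col i) (diam n col' k) \<longleftrightarrow> col \<noteq> col' \<and> i mod int n \<noteq> k mod int n"
proof -
  have "diam n Blue i = diam n Blue k" if "i mod int n = k mod int n"
    using that n by (simp add: diam_eq_iff)
  then have "\<not> edges_cross (chord n i (i + int n)) (chord n k (k + int n))" if "i mod int n = k mod int n"
    using that by (simp add: edges_cross_def diam_def)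
  moreover have "edges_cross (chord n i (i + int n)) (chord n k (k + int n))" if neq: "i mod int n \<noteq> k mod int n"
  proof -
    obtain m where m: "vertex n m = vertex n k" "i \<le> m" "m < i + 2 * int n"
      using n by (rule vertex_rep)
    have mk: "m mod int n = k mod int n" using m n by (intro vertex_eq_imp_mod) auto
    have eq: "chord n k (k + int n) = chord n m (m + int n)"
      using m n by (simp add: chord_def vertex_add_n)
    have "m \<noteq> i" "m \<noteq> i + int n" using mk neq by auto
    then consider "i < m" "m < i + int n" | "i < m - int n" "m - int n < i + int n" using m by linarith
    then show ?thesis
    proof cases
      case 1
      then show ?thesis unfolding eq by (intro edges_cross_chords) auto
    next
      case 2
      have "chord n m (m + int n) = chord n (m - int n) (m - int n + int n)"
        using vertex_add_n[OF n, of "m - int n"] vertex_add_n[OF n, of m]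
        by (simp add: chord_def closed_segment_commute)
      then show ?thesis unfolding eq using 2 edges_cross_chords[of i "m - int n" "i + int n" m n] by simp
    qed
  qed
  ultimately show ?thesis by (auto simp: dedges_cross_def edges_of_dedge) (auto simp: diam_def edges_cross_def)
qed

text \<open>By \<open>edges_cross_imp_inner_end\<close> the crossing edge has an end strictly inside
  the arc of the edge it crosses. Since \<open>starts\<close> and \<open>ends\<close> depend on the
  index modulo \<open>n\<close> only, it does not matter which of two centrally symmetric edges is
  involved.\<close>

lemma cs_pair_cross_imp_inner_end:
  assumes n: "n > 0" and ij: "i < j" "j < i + int n" and D: "D \<in> dedges n"
    and cross: "dedges_cross (cs_pair n i j) D"
  shows "\<exists>m. i < m \<and> m < j \<and> (starts n D m \<or> ends n D m)"
proof -
  \<comment> \<open>The bound \<open>l < k + 2 * int n\<close> is weak enough to include diameters,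
    with \<open>l = k + int n\<close>.\<close>
  have *: "\<exists>m. i < m \<and> m < j \<and> (m mod int n = k mod int n \<or> m mod int n = l mod int n)"
    if "edges_cross e e'" "e \<in> {chord n i j, chord n (i + int n) (j + int n)}"
      "e' \<in> {chord n k l, chord n (k + int n) (l + int n)}" "k < l" "l < k + 2 * int n" for e e' k l
  proof -
    \<comment> \<open>The shifts \<open>s\<close> and \<open>s'\<close> record which of the
      symmetric edges is meant.\<close>
    have "\<exists>s \<in> {0, int n}. e = chord n (i + s) (j + s)" "\<exists>s' \<in> {0, int n}. e' = chord n (k + s') (l + s')"
      using that by simp_all
    then obtain s s' where s: "s \<in> {0, int n}" and s': "s' \<in> {0, int n}"
      and e: "e = chord n (i + s) (j + s)" "e' = chord n (k + s') (l + s')" by blast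
    have "\<exists>m. i + s < m \<and> m < j + s \<and> (vertex n m = vertex n (k + s') \<or> vertex n m = vertex n (l + s'))"
    proof (rule edges_cross_imp_inner_end)
      show "edges_cross (chord n (i + s) (j + s)) (chord n (k + s') (l + s'))" using that e by simp
      show "vertex n (k + s') \<noteq> vertex n (l + s')" using that by (intro vertex_neq) auto
    qed (use ij in auto)
    then obtain m where m: "i + s < m" "m < j + s"
      "vertex n m = vertex n (k + s') \<or> vertex n m = vertex n (l + s')" by auto
    then have "m mod int n = (k + s') mod int n \<or> m mod int n = (l + s') mod int n"
      using vertex_eq_imp_mod[OF n] by blast
    then have "(m - s) mod int n = k mod int n \<or> (m - s) mod int n = l mod int n"
      using s s' by auto
    then show ?thesis using m by (intro exI[of _ "m - s"]) auto
  qed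
  from n D show ?thesis
  proof (cases rule: dedges_cases)
    case (pair k l)
    obtain m where "i < m" "m < j" "m mod int n = k mod int n \<or> m mod int n = l mod int n"
    proof -
      obtain e e' where "edges_cross e e'" "e \<in> edges_of (cs_pair n i j)" "e' \<in> edges_of (cs_pair n k l)"
        using cross unfolding pair dedges_cross_def by blast
      then show ?thesis using *[of e e' k l] pair that unfolding edges_of_dedge by auto
    qed
    then show ?thesis using pair n by (intro exI[of _ m]) (auto simp: ends_simps)
  next
    case (diam col k)
    obtain e e' where "edges_cross e e'" "e \<in> edges_of (cs_pair n i j)" "e' \<in> edges_of (diam n col k)"
      using cross unfolding diam dedges_cross_def by blast
    then obtain m where "i < m" "m < j" "m mod int n = k mod int n \<or> m mod int n = (k + int n) mod int n"
      using *[of e e' k "k + int n"] n unfolding edges_of_dedge by auto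
    then show ?thesis using diam n by (intro exI[of _ m]) (cases col; auto simp: ends_simps)
  qed
qed

section \<open>D-multidissections and degree sequences\<close>

lemma finite_dedges [simp]: "finite (dedges n)"
proof -
  have V: "finite (vertices n)" by (simp add: vertices_def)
  have "edges n \<subseteq> (\<lambda>(a, b). closed_segment a b) ` (vertices n \<times> vertices n)"
    by (auto simp: edges_def)
  then have "finite (edges n)" using V by (meson finite_SigmaI finite_imageI finite_subset)
  moreover have "cs_dedges n \<subseteq> (\<lambda>e. CSPair {e, uminus ` e}) ` edges n"
    by (auto simp: cs_dedges_def)
  ultimately have "finite (cs_dedges n)" by (meson finite_imageI finite_subset)
  moreover have "diam_dedges n \<subseteq> (\<lambda>(c, a). Diam c (closed_segment a (- a))) ` ({Blue, Red} \<times> vertices n)"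
  proof
    fix D assume "D \<in> diam_dedges n"
    then obtain c a where "D = Diam c (closed_segment a (- a))" "a \<in> vertices n"
      by (auto simp: diam_dedges_def diameters_def)
    then show "D \<in> (\<lambda>(c, a). Diam c (closed_segment a (- a))) ` ({Blue, Red} \<times> vertices n)"
      by (intro image_eqI[of _ _ "(c, a)"]) (cases c; auto)+
  qed
  then have "finite (diam_dedges n)" by (rule finite_subset) (use V in auto)
  ultimately show ?thesis by (simp add: dedges_def)
qed

lemma finite_cs_dedges [simp]: "finite (cs_dedges n)" and finite_diam_dedges [simp]: "finite (diam_dedges n)"
  using finite_dedges[of n] by (auto simp: dedges_def)

text \<open>This is \<open>D_multidissections\<close> without the condition on the number of edges,
  which changes in the induction over degree sequences.\<close>

definition noncrossing :: "nat \<Rightarrow> (dedge \<Rightarrow> nat) \<Rightarrow> bool" where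
  "noncrossing n f \<longleftrightarrow> (\<forall>D. D \<notin> dedges n \<longrightarrow> f D = 0) \<and>
     (\<forall>D \<in> dedges n. \<forall>D' \<in> dedges n. dedges_cross D D' \<longrightarrow> f D = 0 \<or> f D' = 0)"

definition outdeg :: "nat \<Rightarrow> (dedge \<Rightarrow> nat) \<Rightarrow> int \<Rightarrow> nat" where
  "outdeg n f m = (\<Sum>D | D \<in> dedges n \<and> starts n D m. f D)"

definition indeg :: "nat \<Rightarrow> (dedge \<Rightarrow> nat) \<Rightarrow> int \<Rightarrow> nat" where
  "indeg n f m = (\<Sum>D | D \<in> dedges n \<and> ends n D m. f D)"

lemma outdeg_pos_iff: "outdeg n f m > 0 \<longleftrightarrow> (\<exists>D \<in> dedges n. starts n D m \<and> f D > 0)"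
  unfolding outdeg_def zero_less_iff_neq_zero by (subst sum_eq_0_iff) auto

lemma indeg_pos_iff: "indeg n f m > 0 \<longleftrightarrow> (\<exists>D \<in> dedges n. ends n D m \<and> f D > 0)"
  unfolding indeg_def zero_less_iff_neq_zero by (subst sum_eq_0_iff) auto

lemma sum_add_one_at:
  fixes f :: "'a \<Rightarrow> nat"
  shows "finite S \<Longrightarrow> sum (f(x := f x + 1)) S = sum f S + of_bool (x \<in> S)"
  by (induction S rule: finite_induct) auto

lemma outdeg_add_one:
  "D \<in> dedges n \<Longrightarrow> outdeg n (f(D := f D + 1)) m = outdeg n f m + of_bool (starts n D m)"
  unfolding outdeg_def by (subst sum_add_one_at) auto

lemma indeg_add_one:
  "D \<in> dedges n \<Longrightarrow> indeg n (f(D := f D + 1)) m = indeg n f m + of_bool (ends n D m)"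
  unfolding indeg_def by (subst sum_add_one_at) auto

lemma dedge_has_end:
  assumes "n > 0" "D \<in> dedges n"
  obtains m where "starts n D m" | m where "ends n D m"
  using assms
proof (cases rule: dedges_cases)
  case (pair i j)
  then show ?thesis using that(1)[of i] assms by (simp add: ends_simps)
next
  case (diam col i)
  then show ?thesis using that(1)[of i] that(2)[of i] assms by (cases col) (simp_all add: ends_simps)
qed

lemma starts_mod_cong:
  assumes "n > 0" "D \<in> dedges n" "i mod int n = k mod int n"
  shows "starts n D i = starts n D k"
  using assms(1,2) by (cases rule: dedges_cases) (use assms in \<open>simp_all add: ends_simps\<close>)

lemma ends_mod_cong:
  assumes "n > 0" "D \<in> dedges n" "i mod int n = k mod int n"
  shows "ends n D i = ends n D k"
  using assms(1,2) by (cases rule: dedges_cases) (use assms in \<open>simp_all add: ends_simps\<close>)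

lemma outdeg_mod_cong: "n > 0 \<Longrightarrow> i mod int n = k mod int n \<Longrightarrow> outdeg n f i = outdeg n f k"
  unfolding outdeg_def using starts_mod_cong[of n _ i k] by (intro sum.cong) auto

lemma indeg_mod_cong: "n > 0 \<Longrightarrow> i mod int n = k mod int n \<Longrightarrow> indeg n f i = indeg n f k"
  unfolding indeg_def using ends_mod_cong[of n _ i k] by (intro sum.cong) auto

text \<open>By \<open>forced\<close>, every solution contains \<open>D\<close>, so solutions for
  \<open>a\<close> and \<open>b\<close> correspond to solutions for the degrees with one copy of
  \<open>D\<close> removed. Putting \<open>D\<close> back creates no crossing by
  \<open>addable\<close>, because an edge that is present has positive degree at each of its
  ends.\<close>

lemma ex1_noncrossing_step:
  assumes D: "D \<in> dedges n"
    and forced: "\<And>f. noncrossing n f \<Longrightarrow> outdeg n f = a \<Longrightarrow> indeg n f = b \<Longrightarrow> f D > 0"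
    and addable: "\<And>D'. D' \<in> dedges n \<Longrightarrow> (\<And>m. starts n D' m \<Longrightarrow> a m > 0) \<Longrightarrow>
        (\<And>m. ends n D' m \<Longrightarrow> b m > 0) \<Longrightarrow> \<not> dedges_cross D D'"
    and a: "\<And>m. starts n D m \<Longrightarrow> a m > 0" and b: "\<And>m. ends n D m \<Longrightarrow> b m > 0"
    and IH: "\<exists>!f. noncrossing n f \<and> outdeg n f = (\<lambda>m. a m - of_bool (starts n D m)) \<and>
        indeg n f = (\<lambda>m. b m - of_bool (ends n D m))"
  shows "\<exists>!f. noncrossing n f \<and> outdeg n f = a \<and> indeg n f = b"
proof -
  from IH obtain f where f: "noncrossing n f" "outdeg n f = (\<lambda>m. a m - of_bool (starts n D m))"
      "indeg n f = (\<lambda>m. b m - of_bool (ends n D m))" by blast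
  let ?g = "f(D := f D + 1)"
  show ?thesis
  proof (rule ex1I[of _ ?g], intro conjI)
    show out: "outdeg n ?g = a"
    proof
      fix m show "outdeg n ?g m = a m" using outdeg_add_one[OF D, of f m] a[of m] f(2)
        by (cases "starts n D m") simp_all
    qed
    show ind: "indeg n ?g = b"
    proof
      fix m show "indeg n ?g m = b m" using indeg_add_one[OF D, of f m] b[of m] f(3)
        by (cases "ends n D m") simp_all
    qed
    have nc: "\<not> dedges_cross D D'" if "D' \<in> dedges n" "?g D' > 0" for D'
    proof (rule addable)
      fix m
      show "a m > 0" if "starts n D' m"
        using outdeg_pos_iff[of n ?g m] that \<open>?g D' > 0\<close> \<open>D' \<in> dedges n\<close> out by auto
      show "b m > 0" if "ends n D' m"
        using indeg_pos_iff[of n ?g m] that \<open>?g D' > 0\<close> \<open>D' \<in> dedges n\<close> ind by auto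
    qed (use that in simp)
    show "noncrossing n ?g"
      unfolding noncrossing_def
    proof (intro conjI allI ballI impI)
      fix D' assume "D' \<notin> dedges n"
      then show "?g D' = 0" using f(1) D by (auto simp: noncrossing_def)
    next
      fix D1 D2 assume D12: "D1 \<in> dedges n" "D2 \<in> dedges n" "dedges_cross D1 D2"
      show "?g D1 = 0 \<or> ?g D2 = 0"
      proof (rule ccontr)
        assume "\<not> (?g D1 = 0 \<or> ?g D2 = 0)"
        then have g: "?g D1 > 0" "?g D2 > 0" by auto
        have "D1 \<noteq> D" "D2 \<noteq> D" using nc[of D1] nc[of D2] g D12 dedges_cross_sym by blast+
        then have "f D1 > 0" "f D2 > 0" using g by auto
        then show False using f(1) D12 by (auto simp: noncrossing_def)
      qed
    qed
  next
    fix h assume h: "noncrossing n h \<and> outdeg n h = a \<and> indeg n h = b"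
    \<comment> \<open>Uniqueness: one copy of \<open>D\<close> is removed from an arbitrary
      solution. By \<open>forced\<close> the multiplicity is positive, so the truncated subtraction
      can be undone.\<close>
    let ?h = "h(D := h D - 1)"
    have pos: "h D > 0" using forced h by blast
    then have hh: "h = ?h(D := ?h D + 1)" by auto
    have "outdeg n ?h = (\<lambda>m. a m - of_bool (starts n D m))"
    proof
      fix m show "outdeg n ?h m = a m - of_bool (starts n D m)"
        using outdeg_add_one[OF D, of ?h m] h unfolding hh[symmetric] by simp
    qed
    moreover have "indeg n ?h = (\<lambda>m. b m - of_bool (ends n D m))"
    proof
      fix m show "indeg n ?h m = b m - of_bool (ends n D m)"
        using indeg_add_one[OF D, of ?h m] h unfolding hh[symmetric] by simp
    qed
    moreover have "noncrossing n ?h"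
      using h unfolding noncrossing_def by (metis diff_0_eq_0 fun_upd_apply)
    ultimately have "?h = f" using IH f by blast
    then show "h = ?g" using hh by metis
  qed
qed

lemma ex_shift_between:
  assumes "n > 0" "i mod int n \<noteq> m mod int n"
  obtains k where "k mod int n = m mod int n" "i < k" "k < i + int n"
proof
  let ?k = "i + (m - i) mod int n"
  have "?k mod int n = (i + (m - i)) mod int n" by (rule mod_add_right_eq)
  then show "?k mod int n = m mod int n" by simp
  have "(m - i) mod int n \<noteq> 0"
    using assms(2) mod_eq_dvd_iff[of m "int n" i] by (simp add: dvd_eq_mod_eq_0)
  moreover have "0 \<le> (m - i) mod int n" "(m - i) mod int n < int n" using assms(1) by simp_all
  ultimately show "i < ?k" "?k < i + int n" by linarith+
qed

text \<open>
  If some vertex with an outgoing end is followed within less than \<open>n\<close> steps by one with an incoming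
  end, a closest such pair must be joined, as in the matching of parentheses: all vertices in
  between are unused, and edges leaving the two ends in any other way cross. If there is no such
  pair, only diameters are possible.
\<close>

proposition ex1_noncrossing:
  assumes n: "n > 0"
    and a: "\<And>i k. i mod int n = k mod int n \<Longrightarrow> a i = a k"
    and b: "\<And>i k. i mod int n = k mod int n \<Longrightarrow> b i = b k"
  shows "\<exists>!f. noncrossing n f \<and> outdeg n f = a \<and> indeg n f = b"
  using a b
proof (induction "\<Sum>m \<in> {0..<int n}. a m + b m" arbitrary: a b rule: less_induct)
  case less
  note a = less.prems(1) and b = less.prems(2)
  \<comment> \<open>This combines \<open>ex1_noncrossing_step\<close> with the induction hypothesis:
    \<open>D\<close> has an end in \<open>{0..<int n}\<close>, so removing a copy lowers the total
    degree over a period.\<close>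
  have reduce: "\<exists>!f. noncrossing n f \<and> outdeg n f = a \<and> indeg n f = b"
    if D: "D \<in> dedges n"
    and forced: "\<And>f. noncrossing n f \<Longrightarrow> outdeg n f = a \<Longrightarrow> indeg n f = b \<Longrightarrow> f D > 0"
    and addable: "\<And>D'. D' \<in> dedges n \<Longrightarrow> (\<And>m. starts n D' m \<Longrightarrow> a m > 0) \<Longrightarrow>
        (\<And>m. ends n D' m \<Longrightarrow> b m > 0) \<Longrightarrow> \<not> dedges_cross D D'"
    and da: "\<And>m. starts n D m \<Longrightarrow> a m > 0" and db: "\<And>m. ends n D m \<Longrightarrow> b m > 0" for D
  proof (rule ex1_noncrossing_step[OF D])
    let ?a = "\<lambda>m. a m - of_bool (starts n D m)" and ?b = "\<lambda>m. b m - of_bool (ends n D m)"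
    have "\<exists>m. 0 \<le> m \<and> m < int n \<and> (starts n D m \<or> ends n D m)"
      using n D
    proof (cases rule: dedge_has_end)
      case (1 m)
      then show ?thesis using starts_mod_cong[OF n D, of m "m mod int n"] n
        by (intro exI[of _ "m mod int n"]) simp
    next
      case (2 m)
      then show ?thesis using ends_mod_cong[OF n D, of m "m mod int n"] n
        by (intro exI[of _ "m mod int n"]) simp
    qed
    then obtain m where m: "0 \<le> m" "m < int n" "starts n D m \<or> ends n D m" by blast
    have "(\<Sum>m \<in> {0..<int n}. ?a m + ?b m) < (\<Sum>m \<in> {0..<int n}. a m + b m)"
    proof (rule sum_strict_mono_ex1)
      have "?a m + ?b m < a m + b m" using m(3) da[of m] db[of m]
        by (cases "starts n D m"; cases "ends n D m") simp_all
      then show "\<exists>m \<in> {0..<int n}. ?a m + ?b m < a m + b m" using m by (intro bexI[of _ m]) auto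
    qed (auto intro!: add_le_mono diff_le_self)
    then show "\<exists>!f. noncrossing n f \<and> outdeg n f = ?a \<and> indeg n f = ?b"
    proof (rule less.hyps)
      fix i k assume ik: "i mod int n = k mod int n"
      show "?a i = ?a k" using a[OF ik] starts_mod_cong[OF n D ik] by simp
      show "?b i = ?b k" using b[OF ik] ends_mod_cong[OF n D ik] by simp
    qed
    show "f D > 0" if "noncrossing n f" "outdeg n f = a" "indeg n f = b" for f
      using that by (rule forced)
    show "\<not> dedges_cross D D'" if "D' \<in> dedges n" "\<And>m. starts n D' m \<Longrightarrow> a m > 0"
      "\<And>m. ends n D' m \<Longrightarrow> b m > 0" for D'
      using that by (rule addable)
  qed (fact da db)+
  let ?pair = "\<lambda>i j. i < j \<and> j < i + int n \<and> a i > 0 \<and> b j > 0"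
  consider (pair) "\<exists>i j. ?pair i j" | (blue) "\<nexists>i j. ?pair i j" "\<exists>m. a m > 0"
    | (red) "\<nexists>i j. ?pair i j" "\<nexists>m. a m > 0" "\<exists>m. b m > 0"
    | (zero) "\<nexists>m. a m > 0" "\<nexists>m. b m > 0"
    by argo
  then show ?case
  proof cases
    case pair
    define P where "P p \<longleftrightarrow> ?pair (fst p) (snd p)" for p
    obtain p where "P p" using pair by (auto simp: P_def)
    \<comment> \<open>A candidate with the shortest arc is chosen.\<close>
    then obtain q where "P q" and q: "\<And>p. P p \<Longrightarrow> nat (snd q - fst q) \<le> nat (snd p - fst p)"
      using ex_has_least_nat[of P p "\<lambda>p. nat (snd p - fst p)"] by blast
    define i j where "i = fst q" and "j = snd q"
    have ij: "i < j" "j < i + int n" "a i > 0" "b j > 0" using \<open>P q\<close> by (simp_all add: P_def i_def j_def)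
    have min: "j - i \<le> l - k" if "k < l" "l < k + int n" "a k > 0" "b l > 0" for k l
    proof -
      have "P (k, l)" using that by (simp add: P_def)
      then have "nat (j - i) \<le> nat (l - k)" using q[of "(k, l)"] by (simp add: i_def j_def)
      then show ?thesis using that by simp
    qed
    \<comment> \<open>An outgoing end strictly between could be paired with \<open>j\<close>, an
      incoming one with \<open>i\<close>, and either arc would be shorter.\<close>
    have empty: "a m = 0" "b m = 0" if "i < m" "m < j" for m
    proof -
      show "a m = 0" using min[of m j] that ij by fastforce
      show "b m = 0" using min[of i m] that ij by fastforce
    qed
    have D: "cs_pair n i j \<in> dedges n" using n ij by (intro cs_pair_in_dedges)
    show ?thesis
    proof (rule reduce[OF D])
      fix f assume f: "noncrossing n f" "outdeg n f = a" "indeg n f = b"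
      have nc: "\<not> dedges_cross D D'" if "D \<in> dedges n" "D' \<in> dedges n" "f D > 0" "f D' > 0" for D D'
        using f(1) that by (auto simp: noncrossing_def)
      \<comment> \<open>Take an edge leaving \<open>i\<close> and one entering \<open>j\<close>. By
        \<open>empty\<close> the first cannot end before \<open>j\<close> and the second cannot
        start after \<open>i\<close>. Unless one of them is the desired pair, each overshoots or is
        a diameter, and in all four combinations they cross.\<close>
      have "outdeg n f i > 0" "indeg n f j > 0" using f ij by simp_all
      then obtain D D' where D: "D \<in> dedges n" "starts n D i" "f D > 0"
        and D': "D' \<in> dedges n" "ends n D' j" "f D' > 0"
        by (auto simp: outdeg_pos_iff indeg_pos_iff)
      have ncD: "\<not> dedges_cross D D'" "\<not> dedges_cross D' D" using nc D D' by blast+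
      have out: "j \<le> l" if "D = cs_pair n i l" "i < l" "l < i + int n" for l
      proof (rule ccontr)
        assume "\<not> j \<le> l"
        moreover have "indeg n f l > 0" unfolding indeg_pos_iff using D that n
          by (intro bexI[of _ D]) (auto simp: ends_simps)
        ultimately show False using empty(2)[of l] f that by auto
      qed
      have inn: "k \<le> i" if "D' = cs_pair n k j" "k < j" "j < k + int n" for k
      proof (rule ccontr)
        assume "\<not> k \<le> i"
        moreover have "outdeg n f k > 0" unfolding outdeg_pos_iff using D' that n
          by (intro bexI[of _ D']) (auto simp: ends_simps)
        ultimately show False using empty(1)[of k] f that by auto
      qed
      show "f (cs_pair n i j) > 0"
      proof (rule ccontr)
        assume *: "\<not> f (cs_pair n i j) > 0"
        have "\<not> D = cs_pair n i j" "\<not> D' = cs_pair n i j" using * D(3) D'(3) by auto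
        note neq = this
        from D(2) consider (1) l where "D = cs_pair n i l" "j < l" "l < i + int n"
          | (2) "D = diam n Blue i"
        proof (unfold starts_def, elim disjE exE conjE)
          fix l assume l: "i < l" "l < i + int n" "D = cs_pair n i l"
          then have "j \<le> l" "l \<noteq> j" using out neq by auto
          then show thesis using that(1)[of l] l by simp
        qed (rule that(2))
        note Dc = this
        from D'(2) consider (1) k where "D' = cs_pair n k j" "k < i" "j < k + int n"
          | (2) "D' = diam n Red j"
        proof (unfold ends_def, elim disjE exE conjE)
          fix k assume k: "k < j" "j < k + int n" "D' = cs_pair n k j"
          then have "k \<le> i" "k \<noteq> i" using inn neq by auto
          then show thesis using that(1)[of k] k by simp
        qed (rule that(2))
        note D'c = this
        have modij: "i mod int n \<noteq> j mod int n"
        proof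
          assume "i mod int n = j mod int n"
          then have "int n dvd j - i" using mod_eq_dvd_iff[of j "int n" i] by auto
          then show False using ij zdvd_not_zless[of "j - i" "int n"] by auto
        qed
        from Dc show False
        proof cases
          case D1: (1 l)
          from D'c show False
          proof cases
            case (1 k)
            then show False using cs_pairs_cross[of k i j l n] D1 ij ncD by auto
          next
            case 2
            then show False using cs_pair_cross_diam[of i j l n Red] D1 ij ncD by auto
          qed
        next
          case D2: 2
          from D'c show False
          proof cases
            case (1 k)
            then show False using cs_pair_cross_diam[of k i j n Blue] D2 ij ncD by auto
          next
            case 2
            then show False using dedges_cross_diams[OF n, of Blue i Red j] D2 modij ncD by auto
          qed
        qed
      qed
    next
      fix D' assume D': "D' \<in> dedges n" "\<And>m. starts n D' m \<Longrightarrow> a m > 0" "\<And>m. ends n D' m \<Longrightarrow> b m > 0"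
      show "\<not> dedges_cross (cs_pair n i j) D'"
      proof
        assume "dedges_cross (cs_pair n i j) D'"
        then obtain m where m: "i < m" "m < j" "starts n D' m \<or> ends n D' m"
          using cs_pair_cross_imp_inner_end[OF n ij(1,2) D'(1)] by blast
        from m(3) show False
        proof
          assume "starts n D' m"
          from D'(2)[OF this] show False using empty[OF m(1,2)] by simp
        next
          assume "ends n D' m"
          from D'(3)[OF this] show False using empty[OF m(1,2)] by simp
        qed
      qed
    next
      show "a m > 0" if "starts n (cs_pair n i j) m" for m
        using that n ij a[of i m] by (simp add: ends_simps)
      show "b m > 0" if "ends n (cs_pair n i j) m" for m
        using that n ij b[of j m] by (simp add: ends_simps)
    qed
  next
    \<comment> \<open>Without candidates, a vertex with an outgoing end excludes incoming ends at
      all other classes modulo \<open>n\<close>. So nothing but the blue diameter can leave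
      \<open>m\<close>, and a red diameter can occur only at the same place, where it does not
      cross.\<close>
    case blue': blue
    then obtain m where blue: "\<nexists>i j. ?pair i j" "a m > 0" by blast
    show ?thesis
    proof (rule reduce[of "diam n Blue m"])
      fix f assume f: "noncrossing n f" "outdeg n f = a" "indeg n f = b"
      then have "outdeg n f m > 0" using blue by simp
      then obtain D where D: "D \<in> dedges n" "starts n D m" "f D > 0" by (auto simp: outdeg_pos_iff)
      have "D \<noteq> cs_pair n m j" if "m < j" "j < m + int n" for j
      proof
        assume "D = cs_pair n m j"
        then have "indeg n f j > 0" unfolding indeg_pos_iff using D that n
          by (intro bexI[of _ D]) (auto simp: ends_simps)
        then have "b j > 0" using f by simp
        then show False using blue that by blast
      qed
      then show "f (diam n Blue m) > 0" using D by (auto simp: starts_def)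
    next
      fix D' assume D': "D' \<in> dedges n" "\<And>m. starts n D' m \<Longrightarrow> a m > 0" "\<And>m. ends n D' m \<Longrightarrow> b m > 0"
      from n D'(1) show "\<not> dedges_cross (diam n Blue m) D'"
      proof (cases rule: dedges_cases)
        case (pair i j)
        then have "a i > 0" "b j > 0" using D' n by (simp_all add: ends_simps)
        then show ?thesis using pair blue by blast
      next
        case (diam col i)
        have "m mod int n = i mod int n" if "col = Red"
        proof (rule ccontr)
          assume "m mod int n \<noteq> i mod int n"
          then obtain k where "k mod int n = i mod int n" "m < k" "k < m + int n"
            by (rule ex_shift_between[OF n])
          moreover have "b k > 0" using D'(3)[of k] diam that n calculation by (simp add: ends_simps)
          ultimately show False using blue by blast
        qed
        then show ?thesis using diam n by (cases col) (auto simp: dedges_cross_diams)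
      qed
    next
      show "a k > 0" if "starts n (diam n Blue m) k" for k
        using that n blue a[of m k] by (simp add: ends_simps)
    qed (use n in \<open>simp_all add: ends_simps diam_in_dedges\<close>)
  next
    \<comment> \<open>All outgoing degrees vanish, whereas pairs and blue diameters have outgoing
      ends; only red diameters remain.\<close>
    case red': red
    then obtain m where red: "\<And>i. a i = 0" "b m > 0" by auto
    show ?thesis
    proof (rule reduce[of "diam n Red m"])
      fix f assume f: "noncrossing n f" "outdeg n f = a" "indeg n f = b"
      then have "indeg n f m > 0" using red by simp
      then obtain D where D: "D \<in> dedges n" "ends n D m" "f D > 0" by (auto simp: indeg_pos_iff)
      have "D \<noteq> cs_pair n i m" if "i < m" "m < i + int n" for i
      proof
        assume "D = cs_pair n i m"
        then have "outdeg n f i > 0" unfolding outdeg_pos_iff using D that n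
          by (intro bexI[of _ D]) (auto simp: ends_simps)
        then show False using red f by auto
      qed
      then show "f (diam n Red m) > 0" using D by (auto simp: ends_def)
    next
      fix D' assume D': "D' \<in> dedges n" "\<And>m. starts n D' m \<Longrightarrow> a m > 0" "\<And>m. ends n D' m \<Longrightarrow> b m > 0"
      from n D'(1) show "\<not> dedges_cross (diam n Red m) D'"
      proof (cases rule: dedges_cases)
        case (pair i j)
        then show ?thesis using D'(2)[of i] red(1) n by (simp add: ends_simps)
      next
        case (diam col i)
        then show ?thesis using D'(2)[of i] red(1) n by (cases col) (simp_all add: ends_simps dedges_cross_diams)
      qed
    next
      show "b k > 0" if "ends n (diam n Red m) k" for k
        using that n red b[of m k] by (simp add: ends_simps)
    qed (use n in \<open>simp_all add: ends_simps diam_in_dedges\<close>)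
  next
    \<comment> \<open>Every D-edge has an end, so vanishing degrees leave only the zero
      function.\<close>
    case zero': zero
    then have zero: "\<And>m. a m = 0" "\<And>m. b m = 0" by auto
    show ?thesis
    proof (rule ex1I[of _ "\<lambda>_. 0"])
      show "noncrossing n (\<lambda>_. 0) \<and> outdeg n (\<lambda>_. 0) = a \<and> indeg n (\<lambda>_. 0) = b"
        using zero by (auto simp: noncrossing_def outdeg_def indeg_def)
    next
      fix f assume f: "noncrossing n f \<and> outdeg n f = a \<and> indeg n f = b"
      have "f D = 0" for D
      proof (cases "D \<in> dedges n")
        case True
        with n show ?thesis
        proof (cases rule: dedge_has_end)
          case (1 m)
          then show ?thesis using f zero outdeg_pos_iff[of n f m] True by auto
        next
          case (2 m)
          then show ?thesis using f zero indeg_pos_iff[of n f m] True by auto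
        qed
      qed (use f in \<open>simp add: noncrossing_def\<close>)
      then show "f = (\<lambda>_. 0)" by blast
    qed
  qed
qed

section \<open>D-rotation\<close>

text \<open>The rotation part of \<open>rot_dedge\<close>, separated from the switching of colours
  because it only translates degree sequences, while \<open>recolour\<close> exchanges outgoing and
  incoming ends of diameters.\<close>

fun turn :: "nat \<Rightarrow> dedge \<Rightarrow> dedge" where
  "turn n (CSPair P) = CSPair ((`) (rot n) ` P)"
| "turn n (Diam col e) = Diam col (rot n ` e)"

fun recolour :: "dedge \<Rightarrow> dedge" where
  "recolour (CSPair P) = CSPair P"
| "recolour (Diam col e) = Diam (switch col) e"

lemma switch_switch [simp]: "switch (switch col) = col"
  by (cases col) simp_all

lemma recolour_recolour [simp]: "recolour (recolour D) = D"
  by (cases D) simp_all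

lemma rot_dedge_eq: "rot_dedge n = recolour \<circ> turn n"
proof
  fix D show "rot_dedge n D = (recolour \<circ> turn n) D" by (cases D) simp_all
qed

lemma turn_recolour: "turn n \<circ> recolour = recolour \<circ> turn n"
proof
  fix D show "(turn n \<circ> recolour) D = (recolour \<circ> turn n) D" by (cases D) simp_all
qed

text \<open>\<open>recolour\<close> is an involution that commutes with \<open>turn n\<close>, so
  only the parity of its exponent survives.\<close>

lemma rot_dedge_funpow:
  "rot_dedge n ^^ d = (if even d then turn n ^^ d else recolour \<circ> turn n ^^ d)"
proof (induction d)
  case (Suc d)
  have comm: "turn n \<circ> (recolour \<circ> g) = recolour \<circ> (turn n \<circ> g)" for g :: "dedge \<Rightarrow> dedge"
    using turn_recolour by (simp add: o_assoc)
  have canc: "recolour \<circ> (recolour \<circ> g) = g" for g :: "dedge \<Rightarrow> dedge"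
    by auto
  have step: "rot_dedge n ^^ Suc d = recolour \<circ> (turn n \<circ> rot_dedge n ^^ d)"
    by (simp add: rot_dedge_eq o_assoc)
  show ?case
  proof (cases "even d")
    case True
    then show ?thesis unfolding step Suc by simp
  next
    case False
    have "rot_dedge n ^^ d = recolour \<circ> turn n ^^ d" unfolding Suc using False by (rule if_not_P)
    then have "rot_dedge n ^^ Suc d = turn n ^^ Suc d" unfolding step by (simp only: comm canc funpow.simps)
    then show ?thesis using False by simp
  qed
qed simp

section \<open>Period of the rotation and its effect on D-edges\<close>

lemma rot_funpow: "(rot n ^^ d) z = cis (real d * (2 * pi / real (2 * n))) * z"
proof -
  define a where "a = 2 * pi / real (2 * n)"
  have "(rot n ^^ d) z = cis (real d * a) * z"
  proof (induction d)
    case (Suc d)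
    have "cis (real (Suc d) * a) = cis a * cis (real d * a)" by (simp add: cis_mult distrib_right)
    then show ?case using Suc by (simp add: rot_def a_def)
  qed simp
  then show ?thesis by (simp only: a_def)
qed

lemma rot_funpow_2n: "n > 0 \<Longrightarrow> rot n ^^ (2 * n) = id"
proof
  fix z assume "n > 0"
  then have "real (2 * n) * (2 * pi / real (2 * n)) = 2 * pi" by simp
  then show "(rot n ^^ (2 * n)) z = id z" unfolding rot_funpow by simp
qed

lemma turn_funpow:
  "(turn n ^^ d) (CSPair P) = CSPair ((`) (rot n ^^ d) ` P)"
  "(turn n ^^ d) (Diam col e) = Diam col ((rot n ^^ d) ` e)"
  by (induction d) (simp_all add: image_image)

lemma turn_funpow_2n:
  assumes "n > 0"
  shows "turn n ^^ (2 * n) = id"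
proof
  fix D show "(turn n ^^ (2 * n)) D = id D"
    by (cases D) (simp_all add: turn_funpow rot_funpow_2n[OF assms])
qed

lemma rot_dedge_funpow_2n: "n > 0 \<Longrightarrow> rot_dedge n ^^ (2 * n) = id"
  by (simp add: rot_dedge_funpow turn_funpow_2n)

lemma bij_funpow_eq_id:
  assumes "f ^^ m = id" "m > 0"
  shows "bij f"
proof -
  obtain k where m: "m = Suc k" using assms(2) gr0_conv_Suc by auto
  show ?thesis
  proof (rule o_bij)
    show "f ^^ k \<circ> f = id" using assms(1) by (simp only: m funpow_Suc_right)
    show "f \<circ> f ^^ k = id" using assms(1) by (simp only: m funpow.simps)
  qed
qed

lemma bij_turn: "n > 0 \<Longrightarrow> bij (turn n)"
  by (rule bij_funpow_eq_id[OF turn_funpow_2n]) auto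

lemma bij_rot_dedge: "n > 0 \<Longrightarrow> bij (rot_dedge n)"
  by (rule bij_funpow_eq_id[OF rot_dedge_funpow_2n]) auto

lemma turn_cs_pair: "turn n (cs_pair n i j) = cs_pair n (i + 1) (j + 1)"
  by (simp add: cs_pair_def rot_chord add.commute add.left_commute)

lemma turn_diam: "turn n (diam n col i) = diam n col (i + 1)"
  by (simp add: diam_def rot_chord add.commute add.left_commute)

lemma turn_funpow_cs_pair: "(turn n ^^ d) (cs_pair n i j) = cs_pair n (i + int d) (j + int d)"
  by (induction d) (simp_all add: turn_cs_pair add.commute add.left_commute)

lemma turn_funpow_diam: "(turn n ^^ d) (diam n col i) = diam n col (i + int d)"
  by (induction d) (simp_all add: turn_diam add.commute add.left_commute)

lemma recolour_cs_pair [simp]: "recolour (cs_pair n i j) = cs_pair n i j"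
  by (simp add: cs_pair_def)

lemma recolour_diam [simp]: "recolour (diam n col i) = diam n (switch col) i"
  by (simp add: diam_def)

lemma turn_funpow_in_dedges:
  assumes "n > 0" "D \<in> dedges n"
  shows "(turn n ^^ d) D \<in> dedges n"
  using assms by (cases rule: dedges_cases)
    (simp_all add: turn_funpow_cs_pair turn_funpow_diam cs_pair_in_dedges diam_in_dedges assms(1))

lemma recolour_in_dedges:
  assumes "n > 0" "D \<in> dedges n"
  shows "recolour D \<in> dedges n"
  using assms by (cases rule: dedges_cases)
    (simp_all add: cs_pair_in_dedges diam_in_dedges assms(1))

lemma edges_cross_rot:
  assumes "edges_cross e e'"
  shows "edges_cross (rot n ` e) (rot n ` e')"
proof -
  have lin: "linear (rot n)" unfolding rot_def by (rule linear_times)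
  have inj: "inj (rot n)" by (rule injI) (simp add: rot_def)
  have "rel_interior (rot n ` S) = rot n ` rel_interior S" for S
    using rel_interior_injective_linear_image[of "rot n" S] lin inj
    by (simp add: linear_conv_bounded_linear)
  then show ?thesis using assms inj
    by (auto simp: edges_cross_def inj_image_eq_iff simp flip: image_Int)
qed

lemma dedges_cross_turn: "dedges_cross D D' \<Longrightarrow> dedges_cross (turn n D) (turn n D')"
proof -
  have inj: "inj (rot n)" by (rule injI) (simp add: rot_def)
  assume *: "dedges_cross D D'"
  have "edges_of (turn n D) = (`) (rot n) ` edges_of D" for D by (cases D) simp_all
  then have "\<exists>e \<in> edges_of (turn n D). \<exists>e' \<in> edges_of (turn n D'). edges_cross e e'"
    using * edges_cross_rot unfolding dedges_cross_def by fastforce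
  then show ?thesis
    using * inj by (cases D; cases D') (auto simp: dedges_cross_def inj_image_eq_iff)
qed

lemma dedges_cross_turn_funpow: "dedges_cross D D' \<Longrightarrow> dedges_cross ((turn n ^^ d) D) ((turn n ^^ d) D')"
  by (induction d) (simp_all add: dedges_cross_turn)

lemma dedges_cross_recolour: "dedges_cross D D' \<Longrightarrow> dedges_cross (recolour D) (recolour D')"
proof -
  have sw: "switch a = switch b \<longleftrightarrow> a = b" for a b by (cases a; cases b) simp_all
  have "edges_of (recolour D) = edges_of D" for D by (cases D) simp_all
  moreover assume "dedges_cross D D'"
  ultimately show ?thesis
    by (cases D; cases D') (auto simp: dedges_cross_def sw)
qed

section \<open>Rotation and recolouring of noncrossing functions\<close>

lemma noncrossing_comp:
  assumes f: "noncrossing n f"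
    and fwd: "\<And>D. D \<in> dedges n \<Longrightarrow> s D \<in> dedges n" and bwd: "\<And>D. s D \<in> dedges n \<Longrightarrow> D \<in> dedges n"
    and cross: "\<And>D D'. dedges_cross D D' \<Longrightarrow> dedges_cross (s D) (s D')"
  shows "noncrossing n (f \<circ> s)"
  unfolding noncrossing_def
proof (intro conjI allI ballI impI)
  fix D assume "D \<notin> dedges n"
  then have "s D \<notin> dedges n" using bwd by blast
  then show "(f \<circ> s) D = 0" using f by (simp add: noncrossing_def)
next
  fix D D' assume "D \<in> dedges n" "D' \<in> dedges n" "dedges_cross D D'"
  then have "s D \<in> dedges n" "s D' \<in> dedges n" "dedges_cross (s D) (s D')" using fwd cross by blast+
  then show "(f \<circ> s) D = 0 \<or> (f \<circ> s) D' = 0" using f by (simp add: noncrossing_def)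
qed

lemma turn_funpow_in_dedges_iff:
  assumes n: "n > 0"
  shows "(turn n ^^ d) D \<in> dedges n \<longleftrightarrow> D \<in> dedges n"
proof
  assume "(turn n ^^ d) D \<in> dedges n"
  \<comment> \<open>Another \<open>2 * n * d - d\<close> steps complete \<open>d\<close> full
    turns.\<close>
  then have "(turn n ^^ (2 * n * d - d)) ((turn n ^^ d) D) \<in> dedges n" by (rule turn_funpow_in_dedges[OF n])
  also have "(turn n ^^ (2 * n * d - d)) ((turn n ^^ d) D) = (turn n ^^ (2 * n * d - d + d)) D"
    by (simp only: funpow_add o_apply)
  also have "2 * n * d - d + d = 2 * n * d" using n by simp
  also have "turn n ^^ (2 * n * d) = (turn n ^^ (2 * n)) ^^ d" by (rule funpow_mult[symmetric])
  finally show "D \<in> dedges n" by (simp add: turn_funpow_2n[OF n])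
qed (rule turn_funpow_in_dedges[OF n])

lemma noncrossing_comp_turn:
  assumes "n > 0" "noncrossing n f"
  shows "noncrossing n (f \<circ> turn n ^^ d)"
  using assms(2) by (rule noncrossing_comp)
    (simp_all add: turn_funpow_in_dedges_iff assms(1) dedges_cross_turn_funpow)

lemma noncrossing_comp_recolour:
  assumes "n > 0" "noncrossing n f"
  shows "noncrossing n (f \<circ> recolour)"
  using assms(2)
proof (rule noncrossing_comp)
  fix D assume "recolour D \<in> dedges n"
  then show "D \<in> dedges n" using recolour_in_dedges[OF assms(1), of "recolour D"] by simp
qed (simp_all add: recolour_in_dedges assms(1) dedges_cross_recolour)

lemma starts_turn_funpow:
  assumes n: "n > 0" and D: "D \<in> dedges n"
  shows "starts n ((turn n ^^ d) D) (m + int d) \<longleftrightarrow> starts n D m"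
proof -
  have "(i + int d) mod int n = (m + int d) mod int n \<longleftrightarrow> i mod int n = m mod int n" for i
    by (simp add: mod_eq_dvd_iff)
  with n D show ?thesis
    by (cases rule: dedges_cases) (simp_all add: turn_funpow_cs_pair turn_funpow_diam ends_simps n)
qed

lemma ends_turn_funpow:
  assumes n: "n > 0" and D: "D \<in> dedges n"
  shows "ends n ((turn n ^^ d) D) (m + int d) \<longleftrightarrow> ends n D m"
proof -
  have "(i + int d) mod int n = (m + int d) mod int n \<longleftrightarrow> i mod int n = m mod int n" for i
    by (simp add: mod_eq_dvd_iff)
  with n D show ?thesis
    by (cases rule: dedges_cases) (simp_all add: turn_funpow_cs_pair turn_funpow_diam ends_simps n)
qed

lemma bij_turn_funpow: "n > 0 \<Longrightarrow> bij (turn n ^^ d)"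
  by (induction d) (simp_all add: bij_turn bij_comp)

text \<open>\<open>turn n ^^ d\<close> maps the D-edges leaving \<open>m\<close> bijectively onto
  those leaving \<open>m + d\<close>.\<close>

lemma outdeg_turn:
  assumes n: "n > 0"
  shows "outdeg n (f \<circ> turn n ^^ d) m = outdeg n f (m + int d)"
  unfolding outdeg_def o_def
proof (rule sum.reindex_bij_betw)
  have inj: "inj (turn n ^^ d)" and surj: "surj (turn n ^^ d)"
    using bij_turn_funpow[OF n] by (auto simp: bij_def)
  show "bij_betw (turn n ^^ d) {D \<in> dedges n. starts n D m} {D \<in> dedges n. starts n D (m + int d)}"
  proof (rule bij_betw_imageI)
    show "inj_on (turn n ^^ d) {D \<in> dedges n. starts n D m}" using inj by (rule inj_on_subset) simp
    show "(turn n ^^ d) ` {D \<in> dedges n. starts n D m} = {D \<in> dedges n. starts n D (m + int d)}"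
    proof (intro equalityI subsetI)
      fix D assume D: "D \<in> {D \<in> dedges n. starts n D (m + int d)}"
      obtain D' where D': "D = (turn n ^^ d) D'" using surj by (meson surjD)
      have "D' \<in> dedges n" using D unfolding D' by (simp add: turn_funpow_in_dedges_iff[OF n])
      moreover have "starts n D' m" using D starts_turn_funpow[OF n \<open>D' \<in> dedges n\<close>] unfolding D' by simp
      ultimately show "D \<in> (turn n ^^ d) ` {D \<in> dedges n. starts n D m}" unfolding D' by blast
    qed (auto simp: turn_funpow_in_dedges_iff[OF n] starts_turn_funpow[OF n])
  qed
qed

lemma indeg_turn:
  assumes n: "n > 0"
  shows "indeg n (f \<circ> turn n ^^ d) m = indeg n f (m + int d)"
  unfolding indeg_def o_def
proof (rule sum.reindex_bij_betw)
  have inj: "inj (turn n ^^ d)" and surj: "surj (turn n ^^ d)"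
    using bij_turn_funpow[OF n] by (auto simp: bij_def)
  show "bij_betw (turn n ^^ d) {D \<in> dedges n. ends n D m} {D \<in> dedges n. ends n D (m + int d)}"
  proof (rule bij_betw_imageI)
    show "inj_on (turn n ^^ d) {D \<in> dedges n. ends n D m}" using inj by (rule inj_on_subset) simp
    show "(turn n ^^ d) ` {D \<in> dedges n. ends n D m} = {D \<in> dedges n. ends n D (m + int d)}"
    proof (intro equalityI subsetI)
      fix D assume D: "D \<in> {D \<in> dedges n. ends n D (m + int d)}"
      obtain D' where D': "D = (turn n ^^ d) D'" using surj by (meson surjD)
      have "D' \<in> dedges n" using D unfolding D' by (simp add: turn_funpow_in_dedges_iff[OF n])
      moreover have "ends n D' m" using D ends_turn_funpow[OF n \<open>D' \<in> dedges n\<close>] unfolding D' by simp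
      ultimately show "D \<in> (turn n ^^ d) ` {D \<in> dedges n. ends n D m}" unfolding D' by blast
    qed (auto simp: turn_funpow_in_dedges_iff[OF n] ends_turn_funpow[OF n])
  qed
qed

text \<open>The uniqueness half of \<open>ex1_noncrossing\<close>, by which invariance can be tested
  on degrees.\<close>

lemma noncrossing_eqI:
  assumes n: "n > 0" and "noncrossing n f" "noncrossing n g" "outdeg n f = outdeg n g" "indeg n f = indeg n g"
  shows "f = g"
proof -
  have "\<exists>!h. noncrossing n h \<and> outdeg n h = outdeg n g \<and> indeg n h = indeg n g"
    using n by (rule ex1_noncrossing) (erule outdeg_mod_cong[OF n] indeg_mod_cong[OF n])+
  then show ?thesis using assms by blast
qed

lemma comp_turn_eq_iff:
  assumes n: "n > 0" and f: "noncrossing n f"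
  shows "f \<circ> turn n ^^ d = f \<longleftrightarrow>
    (\<forall>m. outdeg n f (m + int d) = outdeg n f m) \<and> (\<forall>m. indeg n f (m + int d) = indeg n f m)"
proof
  assume eq: "f \<circ> turn n ^^ d = f"
  show "(\<forall>m. outdeg n f (m + int d) = outdeg n f m) \<and> (\<forall>m. indeg n f (m + int d) = indeg n f m)"
    using outdeg_turn[OF n, of f d] indeg_turn[OF n, of f d] unfolding eq by simp
next
  assume *: "(\<forall>m. outdeg n f (m + int d) = outdeg n f m) \<and> (\<forall>m. indeg n f (m + int d) = indeg n f m)"
  show "f \<circ> turn n ^^ d = f"
  proof (rule noncrossing_eqI[OF n _ f])
    show "noncrossing n (f \<circ> turn n ^^ d)" using n f by (rule noncrossing_comp_turn)
    show "outdeg n (f \<circ> turn n ^^ d) = outdeg n f" using * by (intro ext) (simp only: outdeg_turn[OF n])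
    show "indeg n (f \<circ> turn n ^^ d) = indeg n f" using * by (intro ext) (simp only: indeg_turn[OF n])
  qed
qed

section \<open>Counting edges by degrees and balancing colours\<close>

abbreviation diams_of :: "nat \<Rightarrow> colour \<Rightarrow> dedge set" where
  "diams_of n col \<equiv> range (diam n col)"

lemma diam_dedges_Un: "n > 0 \<Longrightarrow> diam_dedges n = diams_of n Blue \<union> diams_of n Red"
proof -
  have "D \<in> diams_of n Blue \<union> diams_of n Red" if "D = diam n col i" for D col i
    using that by (cases col) auto
  then show "n > 0 \<Longrightarrow> diam_dedges n = diams_of n Blue \<union> diams_of n Red"
    by (auto simp: diam_dedges_eq)
qed

lemma finite_diams_of: "n > 0 \<Longrightarrow> finite (diams_of n col)"
  by (rule finite_subset[OF _ finite_dedges[of n]]) (auto simp: diam_in_dedges)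

lemma sum_dedges:
  fixes h :: "dedge \<Rightarrow> nat"
  assumes n: "n > 0"
  shows "(\<Sum>D \<in> dedges n. h D) = (\<Sum>D \<in> cs_dedges n. h D) + (\<Sum>D \<in> diams_of n Blue. h D) + (\<Sum>D \<in> diams_of n Red. h D)"
proof -
  have "cs_dedges n \<inter> diam_dedges n = {}" using n by (auto simp: cs_dedges_eq diam_dedges_eq)
  then have "(\<Sum>D \<in> dedges n. h D) = (\<Sum>D \<in> cs_dedges n. h D) + (\<Sum>D \<in> diam_dedges n. h D)"
    unfolding dedges_def by (intro sum.union_disjoint) simp_all
  also have "(\<Sum>D \<in> diam_dedges n. h D) = (\<Sum>D \<in> diams_of n Blue. h D) + (\<Sum>D \<in> diams_of n Red. h D)"
    unfolding diam_dedges_Un[OF n] using n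
    by (intro sum.union_disjoint finite_diams_of) (auto simp: diam_eq_iff)
  finally show ?thesis by simp
qed

lemma card_mod_class:
  assumes n: "n > 0"
  shows "card {m \<in> {0..<int n}. i mod int n = m mod int n} = 1"
proof -
  have "{m \<in> {0..<int n}. i mod int n = m mod int n} = {i mod int n}" using n by auto
  then show ?thesis by simp
qed

text \<open>Double counting: over one period a pair and a blue diameter have exactly one outgoing
  end each, a red diameter none.\<close>

lemma sum_outdeg:
  assumes n: "n > 0"
  shows "(\<Sum>m\<in>{0..<int n}. outdeg n f m) = (\<Sum>D \<in> cs_dedges n. f D) + (\<Sum>D \<in> diams_of n Blue. f D)"
proof -
  have "(\<Sum>m\<in>{0..<int n}. outdeg n f m) = (\<Sum>m\<in>{0..<int n}. \<Sum>D\<in>dedges n. if starts n D m then f D else 0)"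
    by (simp add: outdeg_def sum.inter_filter)
  also have "\<dots> = (\<Sum>D\<in>dedges n. \<Sum>m\<in>{0..<int n}. if starts n D m then f D else 0)"
    by (rule sum.swap)
  also have "\<dots> = (\<Sum>D\<in>dedges n. card {m \<in> {0..<int n}. starts n D m} * f D)"
    by (simp flip: sum.inter_filter)
  also have "\<dots> = (\<Sum>D \<in> cs_dedges n. f D) + (\<Sum>D \<in> diams_of n Blue. f D) + (\<Sum>D \<in> diams_of n Red. 0)"
    unfolding sum_dedges[OF n] using n
    by (intro arg_cong2[where f = "(+)"] sum.cong)
      (auto simp: cs_dedges_eq ends_simps card_mod_class simp del: atLeastLessThan_iff)
  finally show ?thesis by simp
qed

lemma sum_indeg:
  assumes n: "n > 0"
  shows "(\<Sum>m\<in>{0..<int n}. indeg n f m) = (\<Sum>D \<in> cs_dedges n. f D) + (\<Sum>D \<in> diams_of n Red. f D)"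
proof -
  have "(\<Sum>m\<in>{0..<int n}. indeg n f m) = (\<Sum>m\<in>{0..<int n}. \<Sum>D\<in>dedges n. if ends n D m then f D else 0)"
    by (simp add: indeg_def sum.inter_filter)
  also have "\<dots> = (\<Sum>D\<in>dedges n. \<Sum>m\<in>{0..<int n}. if ends n D m then f D else 0)"
    by (rule sum.swap)
  also have "\<dots> = (\<Sum>D\<in>dedges n. card {m \<in> {0..<int n}. ends n D m} * f D)"
    by (simp flip: sum.inter_filter)
  also have "\<dots> = (\<Sum>D \<in> cs_dedges n. f D) + (\<Sum>D \<in> diams_of n Blue. 0) + (\<Sum>D \<in> diams_of n Red. f D)"
    unfolding sum_dedges[OF n] using n
    by (intro arg_cong2[where f = "(+)"] sum.cong)
      (auto simp: cs_dedges_eq ends_simps card_mod_class simp del: atLeastLessThan_iff)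
  finally show ?thesis by simp
qed

text \<open>A pair contributes once to the outgoing and once to the incoming total, a diameter to
  just one of them, in agreement with the weights two and one.\<close>

lemma D_multidissections_eq:
  assumes n: "n > 0"
  shows "D_multidissections n k =
    {f. noncrossing n f \<and> (\<Sum>m\<in>{0..<int n}. outdeg n f m) + (\<Sum>m\<in>{0..<int n}. indeg n f m) = k}"
proof -
  have "(\<Sum>D \<in> diam_dedges n. f D) = (\<Sum>D \<in> diams_of n Blue. f D) + (\<Sum>D \<in> diams_of n Red. f D)"
    for f :: "dedge \<Rightarrow> nat"
    unfolding diam_dedges_Un[OF n] using n
    by (intro sum.union_disjoint finite_diams_of) (auto simp: diam_eq_iff)
  note split = this
  have "(\<Sum>D \<in> cs_dedges n. 2 * f D) + (\<Sum>D \<in> diam_dedges n. f D) =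
      (\<Sum>m\<in>{0..<int n}. outdeg n f m) + (\<Sum>m\<in>{0..<int n}. indeg n f m)" for f :: "dedge \<Rightarrow> nat"
    unfolding sum_outdeg[OF n] sum_indeg[OF n] split by (simp flip: sum_distrib_left)
  then show ?thesis
    unfolding D_multidissections_def noncrossing_def by (simp only: conj_assoc)
qed

text \<open>
  The point is that blue and red diameters can only occur together if all of them are supported on
  one and the same diameter.
\<close>

lemma comp_recolour_eq_iff:
  assumes n: "n > 0" and f: "noncrossing n f"
  shows "f \<circ> recolour = f \<longleftrightarrow> (\<Sum>D \<in> diams_of n Blue. f D) = (\<Sum>D \<in> diams_of n Red. f D)"
proof
  assume *: "f \<circ> recolour = f"
  show "(\<Sum>D \<in> diams_of n Blue. f D) = (\<Sum>D \<in> diams_of n Red. f D)"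
  proof (rule sum.reindex_bij_witness[of _ recolour recolour])
    fix D
    show "f (recolour D) = f D" using fun_cong[OF *, of D] by simp
    show "recolour D \<in> diams_of n Red" if "D \<in> diams_of n Blue" using that by auto
    show "recolour D \<in> diams_of n Blue" if "D \<in> diams_of n Red" using that by auto
  qed simp_all
next
  assume *: "(\<Sum>D \<in> diams_of n Blue. f D) = (\<Sum>D \<in> diams_of n Red. f D)"
  have nc: "i mod int n = j mod int n" if "f (diam n Blue i) > 0" "f (diam n Red j) > 0" for i j
  proof (rule ccontr)
    assume "i mod int n \<noteq> j mod int n"
    then have "dedges_cross (diam n Blue i) (diam n Red j)" by (simp add: dedges_cross_diams[OF n])
    then have "f (diam n Blue i) = 0 \<or> f (diam n Red j) = 0"
      using f diam_in_dedges[OF n] by (simp add: noncrossing_def)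
    then show False using that by simp
  qed
  have single: "(\<Sum>D \<in> diams_of n col. f D) = f (diam n col i)"
    if "\<And>j. f (diam n col j) > 0 \<Longrightarrow> j mod int n = i mod int n" for col i
  proof -
    have "(\<Sum>D \<in> diams_of n col. f D) = (\<Sum>D \<in> {diam n col i}. f D)"
    proof (rule sum.mono_neutral_right)
      show "\<forall>D \<in> diams_of n col - {diam n col i}. f D = 0"
      proof
        fix D assume "D \<in> diams_of n col - {diam n col i}"
        then obtain j where j: "D = diam n col j" "diam n col j \<noteq> diam n col i" by auto
        then have "j mod int n \<noteq> i mod int n" using n by (simp add: diam_eq_iff)
        then show "f D = 0" using that[of j] j by auto
      qed
    qed (use finite_diams_of[OF n] in auto)
    then show ?thesis by simp
  qed
  have pos_iff: "(\<Sum>D \<in> diams_of n col. f D) > 0 \<longleftrightarrow> (\<exists>i. f (diam n col i) > 0)" for col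
    unfolding zero_less_iff_neq_zero sum_eq_0_iff[OF finite_diams_of[OF n]] by simp
  have eq: "f (diam n Blue i) = f (diam n Red i)" for i
  proof (cases "\<exists>i. f (diam n Blue i) > 0")
    case True
    then obtain p where p: "f (diam n Blue p) > 0" by blast
    \<comment> \<open>Since the totals agree, a blue diameter forces a red one. By \<open>nc\<close>
      every diameter that is present then coincides with the one through \<open>p\<close>.\<close>
    obtain q where q: "f (diam n Red q) > 0" using True pos_iff[of Blue] pos_iff[of Red] * by auto
    have B: "j mod int n = p mod int n" if "f (diam n Blue j) > 0" for j
      using nc[OF that q] nc[OF p q] by simp
    have R: "j mod int n = p mod int n" if "f (diam n Red j) > 0" for j
      using nc[OF p that] by simp
    show ?thesis
    proof (cases "i mod int n = p mod int n")
      case True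
      then show ?thesis using * single[of Blue i] single[of Red i] B R by simp
    next
      case False
      then have "\<not> f (diam n Blue i) > 0" "\<not> f (diam n Red i) > 0" using B R by blast+
      then show ?thesis by simp
    qed
  next
    case False
    then have "\<not> (\<exists>i. f (diam n Red i) > 0)" using pos_iff[of Blue] pos_iff[of Red] * by simp
    then show ?thesis using False by simp
  qed
  show "f \<circ> recolour = f"
  proof
    fix D show "(f \<circ> recolour) D = f D"
    proof (cases "D \<in> dedges n")
      case True
      with n show ?thesis
      proof (cases rule: dedges_cases)
        case (diam col i)
        then show ?thesis using eq[of i] by (cases col) simp_all
      qed simp
    next
      case False
      then have "recolour D \<notin> dedges n" using recolour_in_dedges[OF n, of "recolour D"] by auto
      then show ?thesis using False f by (simp add: noncrossing_def)
    qed
  qed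
qed

text \<open>For odd \<open>d\<close> the map \<open>recolour \<circ> turn n ^^ d\<close> exchanges
  blue and red diameters, so a fixed point has equally many of both and by
  \<open>comp_recolour_eq_iff\<close> is invariant under \<open>recolour\<close> and hence under
  \<open>turn n ^^ d\<close>. Pairs contribute equally to both degree sums, so this balance is the
  equality of the sums.\<close>

lemma comp_rot_dedge_eq_iff:
  assumes n: "n > 0" and f: "noncrossing n f"
  shows "f \<circ> rot_dedge n ^^ d = f \<longleftrightarrow>
    (\<forall>m. outdeg n f (m + int d) = outdeg n f m) \<and> (\<forall>m. indeg n f (m + int d) = indeg n f m) \<and>
    (odd d \<longrightarrow> (\<Sum>m\<in>{0..<int n}. outdeg n f m) = (\<Sum>m\<in>{0..<int n}. indeg n f m))"
proof (cases "even d")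
  case True
  then show ?thesis by (simp add: rot_dedge_funpow comp_turn_eq_iff[OF n f])
next
  case False
  have bal: "(\<Sum>m\<in>{0..<int n}. outdeg n f m) = (\<Sum>m\<in>{0..<int n}. indeg n f m) \<longleftrightarrow> f \<circ> recolour = f"
    unfolding sum_outdeg[OF n] sum_indeg[OF n] comp_recolour_eq_iff[OF n f] by simp
  have "f \<circ> recolour = f" if fixed: "f \<circ> (recolour \<circ> turn n ^^ d) = f"
    unfolding comp_recolour_eq_iff[OF n f]
  proof -
    let ?s = "recolour \<circ> turn n ^^ d"
    have "(\<Sum>D \<in> diams_of n Blue. f D) = (\<Sum>D \<in> diams_of n Blue. f (?s D))"
      using fun_cong[OF fixed] by simp
    also have "\<dots> = (\<Sum>D \<in> diams_of n Red. f D)"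
    proof (rule sum.reindex_bij_betw, rule bij_betw_imageI)
      show "inj_on ?s (diams_of n Blue)"
        using n by (intro inj_onI) (auto simp: turn_funpow_diam diam_eq_iff mod_eq_dvd_iff)
      show "?s ` diams_of n Blue = diams_of n Red"
      proof (intro equalityI subsetI)
        fix D assume "D \<in> diams_of n Red"
        then obtain i where "D = diam n Red i" by auto
        then have "D = ?s (diam n Blue (i - int d))" by (simp add: turn_funpow_diam)
        then show "D \<in> ?s ` diams_of n Blue" by blast
      qed (auto simp: turn_funpow_diam)
    qed
    finally show "(\<Sum>D \<in> diams_of n Blue. f D) = (\<Sum>D \<in> diams_of n Red. f D)" .
  qed
  then have "f \<circ> (recolour \<circ> turn n ^^ d) = f \<longleftrightarrow> f \<circ> recolour = f \<and> f \<circ> turn n ^^ d = f"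
    unfolding o_assoc by auto
  then show ?thesis
    using False bal by (auto simp: rot_dedge_funpow comp_turn_eq_iff[OF n f])
qed

section \<open>Complete homogeneous symmetric polynomials\<close>

definition row_words :: "nat \<Rightarrow> nat \<Rightarrow> nat list set" where
  "row_words n m = {is. length is = m \<and> sorted is \<and> set is \<subseteq> {..<n}}"

abbreviation row_weight :: "'a::comm_semiring_1 list \<Rightarrow> nat list \<Rightarrow> 'a" where
  "row_weight xs is \<equiv> \<Prod>i\<leftarrow>is. xs ! i"

lemma complete_homogeneous_row_words:
  "complete_homogeneous m xs = (\<Sum>is \<in> row_words (length xs) m. row_weight xs is)"
  by (simp add: complete_homogeneous_def row_words_def)

lemma finite_row_words [simp]: "finite (row_words n m)"
  by (rule finite_subset[OF _ finite_lists_length_eq[of "{..<n}" m]]) (auto simp: row_words_def)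

lemma complete_homogeneous_0 [simp]: "complete_homogeneous 0 xs = 1"
proof -
  have "row_words (length xs) 0 = {[]}" by (auto simp: row_words_def)
  then show ?thesis by (simp add: complete_homogeneous_row_words)
qed

lemma complete_homogeneous_Suc_Nil [simp]: "complete_homogeneous (Suc m) [] = 0"
proof -
  have "row_words 0 (Suc m) = {}" by (auto simp: row_words_def)
  then show ?thesis by (simp add: complete_homogeneous_row_words)
qed

text \<open>Case distinction on the first letter: if it is not \<open>0\<close>, sortedness makes
  all letters positive and they can be lowered by one.\<close>

lemma row_words_Suc: "row_words (Suc n) (Suc m) = (#) 0 ` row_words (Suc n) m \<union> map Suc ` row_words n (Suc m)"
proof (intro equalityI subsetI)
  fix ks assume "ks \<in> row_words (Suc n) (Suc m)"
  then obtain x xs where ks: "ks = x # xs" "sorted (x # xs)" "length xs = m" "set (x # xs) \<subseteq> {..<Suc n}"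
    by (auto simp: row_words_def length_Suc_conv)
  show "ks \<in> (#) 0 ` row_words (Suc n) m \<union> map Suc ` row_words n (Suc m)"
  proof (cases "x = 0")
    case True
    then show ?thesis using ks by (auto simp: row_words_def)
  next
    case False
    have pos: "1 \<le> i" if "i \<in> set ks" for i
      using that ks False by auto
    have "map Suc (map (\<lambda>i. i - 1) ks) = ks"
      unfolding map_map o_def
    proof (rule map_idI)
      fix i assume "i \<in> set ks"
      from pos[OF this] show "Suc (i - 1) = i" by simp
    qed
    moreover have "map (\<lambda>i. i - 1) ks \<in> row_words n (Suc m)"
    proof -
      have "sorted_wrt (\<lambda>x y. x - 1 \<le> y - 1) ks"
        by (rule sorted_wrt_mono_rel[of ks "(\<le>)"]) (use ks in auto)
      moreover have "i - 1 < n" if "i \<in> set ks" for i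
      proof -
        have "i < Suc n" using that ks by auto
        then show ?thesis using pos[OF that] by simp
      qed
      ultimately show ?thesis using ks by (auto simp: row_words_def sorted_map)
    qed
    ultimately show ?thesis by (metis UnCI imageI)
  qed
next
  fix ks assume "ks \<in> (#) 0 ` row_words (Suc n) m \<union> map Suc ` row_words n (Suc m)"
  then show "ks \<in> row_words (Suc n) (Suc m)"
    by (auto simp: row_words_def sorted_map)
qed

lemma complete_homogeneous_Suc_Cons:
  "complete_homogeneous (Suc m) (y # ys) =
     y * complete_homogeneous m (y # ys) + complete_homogeneous (Suc m) ys"
proof -
  let ?w = "row_weight (y # ys)" and ?n = "length ys"
  have "(\<Sum>is \<in> row_words (Suc ?n) (Suc m). ?w is) =
      (\<Sum>is \<in> (#) 0 ` row_words (Suc ?n) m. ?w is) + (\<Sum>is \<in> map Suc ` row_words ?n (Suc m). ?w is)"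
    unfolding row_words_Suc by (rule sum.union_disjoint) auto
  also have "(\<Sum>is \<in> (#) 0 ` row_words (Suc ?n) m. ?w is) = y * (\<Sum>is \<in> row_words (Suc ?n) m. ?w is)"
    by (subst sum.reindex) (auto simp: sum_distrib_left)
  also have "(\<Sum>is \<in> map Suc ` row_words ?n (Suc m). ?w is) = (\<Sum>is \<in> row_words ?n (Suc m). row_weight ys is)"
    by (subst sum.reindex) (auto simp: o_def inj_on_def)
  finally show ?thesis by (simp add: complete_homogeneous_row_words)
qed

lemma complete_homogeneous_single: "complete_homogeneous m [c] = c ^ m"
  by (induction m) (simp_all add: complete_homogeneous_Suc_Cons)

lemma complete_homogeneous_1_1: "complete_homogeneous m [1, 1 :: 'a::comm_ring_1] = of_nat (m + 1)"
  by (induction m) (simp_all add: complete_homogeneous_Suc_Cons complete_homogeneous_single algebra_simps)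

lemma complete_homogeneous_1_m1:
  "complete_homogeneous m [1, - 1 :: 'a::comm_ring_1] = of_bool (even m)"
  by (induction m) (auto simp: complete_homogeneous_Suc_Cons complete_homogeneous_single)

text \<open>The generating function of the complete homogeneous polynomials, stated without
  division. The recursion \<open>complete_homogeneous_Suc_Cons\<close> cancels one linear factor per
  variable.\<close>

lemma complete_homogeneous_fps:
  fixes ys :: "'a::comm_ring_1 list"
  shows "Abs_fps (\<lambda>m. complete_homogeneous m ys) * (\<Prod>y\<leftarrow>ys. 1 - fps_const y * fps_X) = 1"
proof (induction ys)
  case Nil
  have "complete_homogeneous m ([] :: 'a list) = of_bool (m = 0)" for m by (cases m) auto
  then show ?case by (auto intro!: fps_ext)
next
  case (Cons y ys)
  let ?H = "\<lambda>ys. Abs_fps (\<lambda>m. complete_homogeneous m ys)"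
  have "?H (y # ys) = ?H ys + fps_const y * (fps_X * ?H (y # ys))"
  proof (rule fps_ext)
    fix m show "fps_nth (?H (y # ys)) m = fps_nth (?H ys + fps_const y * (fps_X * ?H (y # ys))) m"
      by (cases m) (simp_all add: complete_homogeneous_Suc_Cons)
  qed
  then have "?H (y # ys) * (1 - fps_const y * fps_X) = ?H ys"
    by (simp add: algebra_simps)
  then show ?case using Cons by (simp add: mult.assoc[symmetric])
qed

section \<open>Counting lists and evaluating at roots of unity\<close>

lemma finite_lists_scaled_sum:
  fixes r :: nat
  assumes "r > 0"
  shows "finite {l. length l = g \<and> r * sum_list l = j}"
proof (rule finite_subset)
  show "{l. length l = g \<and> r * sum_list l = j} \<subseteq> {l. set l \<subseteq> {..j} \<and> length l = g}"
  proof
    fix l assume l: "l \<in> {l. length l = g \<and> r * sum_list l = j}"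
    have "x \<le> j" if "x \<in> set l" for x
    proof -
      have "x \<le> sum_list l" using that by (intro member_le_sum_list) auto
      also have "\<dots> \<le> r * sum_list l" using assms by simp
      finally show ?thesis using l by simp
    qed
    then show "l \<in> {l. set l \<subseteq> {..j} \<and> length l = g}" using l by auto
  qed
qed (rule finite_lists_length_eq, simp)

text \<open>A list of length \<open>g + 1\<close> either has head \<open>0\<close> or arises from
  another one by raising the head by one, which costs \<open>r\<close>. This gives the recursion
  that cancels one factor \<open>1 - fps_X ^ r\<close>.\<close>

lemma sum_list_card_fps:
  assumes "r > 0"
  shows "Abs_fps (\<lambda>j. of_nat (card {l. length l = g \<and> r * sum_list l = j}) :: 'a::comm_ring_1)
           * (1 - fps_X ^ r) ^ g = 1"
proof (induction g)
  case 0
  have "card {l :: nat list. l = [] \<and> r * sum_list l = j} = of_bool (j = 0)" for j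
  proof -
    have "{l :: nat list. l = [] \<and> r * sum_list l = j} = (if j = 0 then {[]} else {})" by auto
    then show ?thesis by simp
  qed
  then show ?case by (auto intro!: fps_ext)
next
  case (Suc g)
  define L where "L g j = {l. length l = g \<and> r * sum_list l = j}" for g j
  let ?C = "\<lambda>g. Abs_fps (\<lambda>j. of_nat (card (L g j)) :: 'a)"
  have fin: "finite (L g j)" for g j
    unfolding L_def using assms by (rule finite_lists_scaled_sum)
  define up where "up l = Suc (hd l) # tl l" for l
  have L_Suc: "L (Suc g) j = (#) 0 ` L g j \<union> (if j < r then {} else up ` L (Suc g) (j - r))" for j
  proof (intro equalityI subsetI)
    fix l assume "l \<in> L (Suc g) j"
    then obtain x l' where l: "l = x # l'" "length l' = g" "r * (x + sum_list l') = j"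
      by (auto simp: L_def length_Suc_conv)
    show "l \<in> (#) 0 ` L g j \<union> (if j < r then {} else up ` L (Suc g) (j - r))"
    proof (cases x)
      case 0
      then show ?thesis using l by (auto simp: L_def)
    next
      case (Suc y)
      then have "\<not> j < r" "y # l' \<in> L (Suc g) (j - r)" "l = up (y # l')"
        using l by (auto simp: L_def up_def)
      then show ?thesis by auto
    qed
  next
    fix l assume "l \<in> (#) 0 ` L g j \<union> (if j < r then {} else up ` L (Suc g) (j - r))"
    then consider "l \<in> (#) 0 ` L g j" | "\<not> j < r" "l \<in> up ` L (Suc g) (j - r)"
      by (auto split: if_splits)
    then show "l \<in> L (Suc g) j"
      by cases (auto simp: L_def up_def length_Suc_conv)
  qed
  have "card (L (Suc g) j) = card (L g j) + (if j < r then 0 else card (L (Suc g) (j - r)))" for j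
  proof -
    have nonempty: "l \<noteq> []" if "l \<in> L (Suc g) (j - r)" for l
      using that by (auto simp: L_def)
    have "inj_on up (L (Suc g) (j - r))"
    proof (rule inj_onI)
      fix l l' assume "l \<in> L (Suc g) (j - r)" "l' \<in> L (Suc g) (j - r)" "up l = up l'"
      then show "l = l'" using nonempty[of l] nonempty[of l'] by (cases l; cases l') (simp_all add: up_def)
    qed
    then have "card (up ` L (Suc g) (j - r)) = card (L (Suc g) (j - r))" by (rule card_image)
    moreover have "card ((#) 0 ` L g j) = card (L g j)" by (rule card_image) simp
    moreover have "card ((#) 0 ` L g j \<union> up ` L (Suc g) (j - r)) =
        card ((#) 0 ` L g j) + card (up ` L (Suc g) (j - r))"
      by (rule card_Un_disjoint) (auto simp: fin up_def)
    ultimately show ?thesis using L_Suc[of j] by (cases "j < r") simp_all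
  qed
  then have "?C (Suc g) = ?C g + fps_X ^ r * ?C (Suc g)"
    by (intro fps_ext) (simp add: fps_X_power_mult_nth)
  then have "?C (Suc g) * (1 - fps_X ^ r) = ?C g" by (simp add: algebra_simps)
  then show ?case using Suc by (simp add: L_def mult.assoc[symmetric])
qed

text \<open>Both sides vanish at the \<open>r\<close> distinct powers of \<open>inverse w\<close>
  and agree at \<open>0\<close>. These are \<open>r + 1\<close> points, while the degrees are at
  most \<open>r\<close>.\<close>

lemma prod_roots_of_unity:
  fixes w :: complex
  assumes r: "r > 0" and w: "\<And>i. w ^ i = 1 \<longleftrightarrow> r dvd i"
  shows "(\<Prod>i<r. [:1, - (w ^ i):]) = 1 - Polynomial.monom 1 r"
proof -
  have w0: "w \<noteq> 0" using w[of r] r by (auto simp: power_0_left)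
  have inj: "inj_on (\<lambda>i. inverse w ^ i) {..<r}"
  proof (rule inj_onI)
    have *: "i = j" if "i \<le> j" "j < r" "inverse w ^ i = inverse w ^ j" for i j
    proof -
      have "w ^ i = w ^ j" using that(3) by (simp add: power_inverse)
      moreover have "w ^ j = w ^ i * w ^ (j - i)" using that by (simp flip: power_add)
      ultimately have "w ^ i * w ^ (j - i) = w ^ i * 1" by simp
      then have "w ^ (j - i) = 1" using w0 by (simp only: mult_cancel_left) simp
      then have "r dvd j - i" using w by blast
      then have "\<not> (0 < j - i \<and> j - i < r)" using nat_dvd_not_less by blast
      then show ?thesis using that by linarith
    qed
    fix i j assume "i \<in> {..<r}" "j \<in> {..<r}" "inverse w ^ i = inverse w ^ j"
    then show "i = j" using *[of i j] *[of j i] by (cases "i \<le> j") auto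
  qed
  show ?thesis
  proof (rule poly_eqI_degree[of "insert 0 ((\<lambda>i. inverse w ^ i) ` {..<r})"])
    fix x assume "x \<in> insert 0 ((\<lambda>i. inverse w ^ i) ` {..<r})"
    then consider "x = 0" | i where "i < r" "x = inverse w ^ i" by auto
    then show "poly (\<Prod>i<r. [:1, - (w ^ i):]) x = poly (1 - Polynomial.monom 1 r) x"
    proof cases
      case 1
      then show ?thesis using r by (simp add: poly_prod poly_monom power_0_left)
    next
      case (2 i)
      have "w ^ i * x = 1" using 2 w0 by (simp flip: power_mult_distrib)
      then have "(\<Prod>j<r. 1 - w ^ j * x) = 0" using 2 by (intro prod_zero) auto
      moreover have "x ^ r = 1"
      proof -
        have "x ^ r = inverse ((w ^ r) ^ i)"
          unfolding 2 by (simp add: power_inverse mult.commute flip: power_mult)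
        then show ?thesis using w[of r] by simp
      qed
      ultimately show ?thesis by (simp add: poly_prod poly_monom mult.commute[of x])
    qed
  next
    have c: "card (insert 0 ((\<lambda>i. inverse w ^ i) ` {..<r})) = Suc r"
      using inj w0 by (subst card_insert_disjoint) (auto simp: card_image)
    have "degree (\<Prod>i<r. [:1, - (w ^ i):]) \<le> (\<Sum>i<r. degree [:1, - (w ^ i):])"
      using degree_prod_sum_le[of "{..<r}" "\<lambda>i. [:1, - (w ^ i):]"] by (simp add: o_def)
    also have "\<dots> \<le> (\<Sum>i<r. 1)" by (intro sum_mono) simp
    finally show "degree (\<Prod>i<r. [:1, - (w ^ i):]) < card (insert 0 ((\<lambda>i. inverse w ^ i) ` {..<r}))"
      unfolding c by simp
    have "degree (1 - Polynomial.monom 1 r :: complex poly) \<le> r"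
      by (intro degree_diff_le) (auto simp: degree_monom_le)
    then show "degree (1 - Polynomial.monom 1 r :: complex poly) < card (insert 0 ((\<lambda>i. inverse w ^ i) ` {..<r}))"
      unfolding c by simp
  qed
qed

text \<open>The variables run \<open>g\<close> times through all \<open>r\<close>-th roots of unity,
  so the product of linear factors in the generating function is \<open>(1 - fps_X ^ r) ^ g\<close>,
  exactly as for the lists.\<close>

lemma complete_homogeneous_roots_of_unity:
  fixes w :: complex
  assumes r: "r > 0" and w: "\<And>i. w ^ i = 1 \<longleftrightarrow> r dvd i"
  shows "complete_homogeneous j (map (\<lambda>i. w ^ i) [0..<g * r]) =
     of_nat (card {l. length l = g \<and> r * sum_list l = j})"
proof -
  let ?f = "\<lambda>i. 1 - fps_const (w ^ i) * fps_X"
  have "fps_of_poly (\<Prod>i<r. [:1, - (w ^ i):]) = fps_of_poly (1 - Polynomial.monom 1 r)"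
    using prod_roots_of_unity[OF assms] by simp
  then have 1: "(\<Prod>i<r. ?f i) = 1 - fps_X ^ r"
    by (simp add: fps_of_poly_prod fps_of_poly_pCons fps_of_poly_diff fps_of_poly_monom' flip: fps_const_neg)
  have per: "w ^ (m * r + i) = w ^ i" for m i using w[of "m * r"] by (simp add: power_add)
  have "(\<Prod>y\<leftarrow>map (\<lambda>i. w ^ i) [0..<g * r]. 1 - fps_const y * fps_X) = (\<Prod>i<g * r. ?f i)"
    by (simp add: o_def prod.distinct_set_conv_list[symmetric] lessThan_atLeast0)
  also have "\<dots> = (\<Prod>m<g. \<Prod>i\<in>{m * r..<m * r + r}. ?f i)"
    by (rule prod.nat_group[symmetric])
  also have "\<dots> = (\<Prod>m<g. \<Prod>i<r. ?f i)"
  proof (rule prod.cong)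
    fix m
    have "(\<Prod>i\<in>{m * r..<m * r + r}. ?f i) = (\<Prod>i\<in>{0..<r}. ?f (i + m * r))"
      using prod.shift_bounds_nat_ivl[of ?f 0 "m * r" r] by (simp add: add.commute)
    then show "(\<Prod>i\<in>{m * r..<m * r + r}. ?f i) = (\<Prod>i<r. ?f i)"
      unfolding lessThan_atLeast0 by (simp only: add.commute[of _ "m * r"] per)
  qed simp
  also have "\<dots> = (1 - fps_X ^ r) ^ g" by (simp add: 1)
  finally have P: "(\<Prod>y\<leftarrow>map (\<lambda>i. w ^ i) [0..<g * r]. 1 - fps_const y * fps_X) = (1 - fps_X ^ r) ^ g" .
  let ?H = "Abs_fps (\<lambda>m. complete_homogeneous m (map (\<lambda>i. w ^ i) [0..<g * r]))"
  let ?C = "Abs_fps (\<lambda>j. of_nat (card {l. length l = g \<and> r * sum_list l = j}) :: complex)"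
  have H: "?H * (1 - fps_X ^ r) ^ g = 1"
    using complete_homogeneous_fps[of "map (\<lambda>i. w ^ i) [0..<g * r]"] unfolding P .
  have C: "?C * (1 - fps_X ^ r) ^ g = 1" by (rule sum_list_card_fps[OF r])
  \<comment> \<open>Two inverses of the same power series are equal.\<close>
  have "?H = ?H * (?C * (1 - fps_X ^ r) ^ g)" unfolding C by simp
  also have "\<dots> = ?H * (1 - fps_X ^ r) ^ g * ?C" by (simp only: ac_simps)
  also have "\<dots> = ?C" unfolding H by simp
  finally have "fps_nth ?H j = fps_nth ?C j" by (rule arg_cong)
  then show ?thesis by simp
qed

section \<open>Schur polynomials of two-row shapes\<close>

text \<open>
  The Jacobi--Trudi identity for two rows is proved by exchanging tails: a pair of rows \<open>u\<close>, \<open>v\<close>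
  that is not column strict first fails in some column \<open>j\<close>, and exchanging the tails \<open>u ! j, \<dots>\<close> and
  \<open>v ! (j + 1), \<dots>\<close> gives an arbitrary pair of rows of lengths one more and one less. In the
  inverse direction \<open>j\<close> is the first column with \<open>u ! j \<le> v ! j\<close>, a missing entry of \<open>v\<close>
  counting as infinite.
\<close>

definition first_bad :: "nat list \<Rightarrow> nat list \<Rightarrow> nat \<Rightarrow> bool" where
  "first_bad u v j \<longleftrightarrow> j < length v \<and> v ! j \<le> u ! j \<and> (\<forall>i<j. u ! i < v ! i)"

definition first_good :: "nat list \<Rightarrow> nat list \<Rightarrow> nat \<Rightarrow> bool" where
  "first_good u v j \<longleftrightarrow> j \<le> length v \<and> (j < length v \<longrightarrow> u ! j \<le> v ! j) \<and> (\<forall>i<j. v ! i < u ! i)"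

lemma first_bad_unique:
  assumes "first_bad u v i" "first_bad u v j"
  shows "i = j"
proof -
  have "\<not> i < j" if "first_bad u v i" "first_bad u v j" for i j
  proof
    assume "i < j"
    then have "u ! i < v ! i \<and> v ! i \<le> u ! i \<or> v ! i < u ! i \<and> u ! i \<le> v ! i"
      using that by (simp add: first_bad_def)
    then show False by linarith
  qed
  from this[of i j] this[of j i] assms show ?thesis by simp
qed

lemma first_good_unique:
  assumes "first_good u v i" "first_good u v j"
  shows "i = j"
proof -
  have "\<not> i < j" if "first_good u v i" "first_good u v j" for i j
  proof
    assume "i < j"
    then have "u ! i < v ! i \<and> v ! i \<le> u ! i \<or> v ! i < u ! i \<and> u ! i \<le> v ! i"
      using that by (simp add: first_good_def)
    then show False by linarith
  qed
  from this[of i j] this[of j i] assms show ?thesis by simp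
qed

lemma ex_first_bad:
  assumes "\<not> (\<forall>j<length v. u ! j < v ! j)"
  shows "\<exists>j. first_bad u v j"
proof -
  obtain j where j: "j < length v" "v ! j \<le> u ! j" using assms by (auto simp: not_less)
  let ?P = "\<lambda>j. j < length v \<and> v ! j \<le> u ! j"
  have P: "?P (LEAST j. ?P j)" using j by (intro LeastI[of ?P j]) simp
  have "u ! i < v ! i" if "i < (LEAST j. ?P j)" for i
    using not_less_Least[OF that] that P by simp
  then show ?thesis using P unfolding first_bad_def by blast
qed

lemma ex_first_good: "\<exists>j. first_good u v j"
proof -
  let ?P = "\<lambda>j. j = length v \<or> j < length v \<and> u ! j \<le> v ! j"
  have P: "?P (LEAST j. ?P j)" by (rule LeastI[of ?P "length v"]) simp
  have "v ! i < u ! i" if "i < (LEAST j. ?P j)" for i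
    using not_less_Least[OF that] that P by auto
  then show ?thesis using P unfolding first_good_def by (intro exI[of _ "LEAST j. ?P j"]) auto
qed

section \<open>Exchanging the tails of two rows\<close>

lemma sorted_take_append_drop:
  assumes "sorted u" "sorted v"
    and "\<And>i k. i < a \<Longrightarrow> i < length u \<Longrightarrow> b \<le> k \<Longrightarrow> k < length v \<Longrightarrow> u ! i \<le> v ! k"
  shows "sorted (take a u @ drop b v)"
proof -
  have "x \<le> y" if x: "x \<in> set (take a u)" and y: "y \<in> set (drop b v)" for x y
  proof -
    obtain i where "x = u ! i" "i < a" "i < length u" using x by (auto simp: in_set_conv_nth)
    moreover obtain k where "y = v ! (b + k)" "b + k < length v" using y by (auto simp: in_set_conv_nth)
    ultimately show ?thesis using assms(3)[of i "b + k"] by simp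
  qed
  then show ?thesis using assms by (simp add: sorted_append sorted_wrt_take sorted_wrt_drop)
qed

text \<open>The longer row stays sorted because \<open>v ! j \<le> u ! j\<close>, the shorter one
  because \<open>u ! i < v ! i\<close> before column \<open>j\<close>. The last claim lets
  \<open>j\<close> be recovered from the new pair, so the exchange can be undone.\<close>

lemma swap_tails_bad:
  assumes u: "u \<in> row_words n p" and v: "v \<in> row_words n (Suc q)" and "q < p" and j: "first_bad u v j"
  shows "take (Suc j) v @ drop j u \<in> row_words n (Suc p)"
    and "take j u @ drop (Suc j) v \<in> row_words n q"
    and "first_good (take (Suc j) v @ drop j u) (take j u @ drop (Suc j) v) j"
proof -
  have len: "length u = p" "length v = Suc q" and su: "sorted u" and sv: "sorted v"
    and sub: "set u \<subseteq> {..<n}" "set v \<subseteq> {..<n}" using u v by (auto simp: row_words_def)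
  have jq: "j < Suc q" "v ! j \<le> u ! j" "\<And>i. i < j \<Longrightarrow> u ! i < v ! i"
    using j len by (auto simp: first_bad_def)
  have "v ! i \<le> u ! k" if "i \<le> j" "j \<le> k" "k < p" for i k
  proof -
    have "v ! i \<le> v ! j" using sv that jq len by (intro sorted_nth_mono) auto
    also have "\<dots> \<le> u ! j" by (rule jq)
    also have "\<dots> \<le> u ! k" using su that len by (intro sorted_nth_mono) auto
    finally show ?thesis .
  qed
  then have "sorted (take (Suc j) v @ drop j u)"
    using su sv len by (intro sorted_take_append_drop) auto
  then show "take (Suc j) v @ drop j u \<in> row_words n (Suc p)"
    using len sub jq \<open>q < p\<close> by (auto simp: row_words_def dest!: in_set_takeD in_set_dropD)
  have "u ! i \<le> v ! k" if "i < j" "Suc j \<le> k" "k < Suc q" for i k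
  proof -
    have "v ! i \<le> v ! k" using sv that jq len by (intro sorted_nth_mono) auto
    then show ?thesis using jq(3)[OF that(1)] by simp
  qed
  then have "sorted (take j u @ drop (Suc j) v)"
    using su sv len by (intro sorted_take_append_drop) auto
  then show "take j u @ drop (Suc j) v \<in> row_words n q"
    using len sub jq \<open>q < p\<close> by (auto simp: row_words_def dest!: in_set_takeD in_set_dropD)
  \<comment> \<open>In the new pair, column \<open>j\<close> holds \<open>v ! j\<close> and
    \<open>v ! Suc j\<close>; for \<open>j = q\<close> the second row has no entry there.\<close>
  have "v ! j \<le> v ! Suc j" if "j < q" using sv that len by (intro sorted_nth_mono) auto
  then show "first_good (take (Suc j) v @ drop j u) (take j u @ drop (Suc j) v) j"
    using len jq \<open>q < p\<close> by (auto simp: first_good_def nth_append)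
qed

text \<open>The counterpart of \<open>swap_tails_bad\<close> with the two inequalities in exchanged
  roles. For \<open>j = q\<close> the tail taken from \<open>v\<close> is empty.\<close>

lemma swap_tails_good:
  assumes u: "u \<in> row_words n (Suc p)" and v: "v \<in> row_words n q" and "q < p" and j: "first_good u v j"
  shows "take j v @ drop (Suc j) u \<in> row_words n p"
    and "take (Suc j) u @ drop j v \<in> row_words n (Suc q)"
    and "first_bad (take j v @ drop (Suc j) u) (take (Suc j) u @ drop j v) j"
proof -
  have len: "length u = Suc p" "length v = q" and su: "sorted u" and sv: "sorted v"
    and sub: "set u \<subseteq> {..<n}" "set v \<subseteq> {..<n}" using u v by (auto simp: row_words_def)
  have jq: "j \<le> q" "j < q \<Longrightarrow> u ! j \<le> v ! j" "\<And>i. i < j \<Longrightarrow> v ! i < u ! i"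
    using j len by (auto simp: first_good_def)
  have "v ! i \<le> u ! k" if "i < j" "Suc j \<le> k" "k < Suc p" for i k
  proof -
    have "u ! i \<le> u ! k" using su that jq len by (intro sorted_nth_mono) auto
    then show ?thesis using jq(3)[OF that(1)] by simp
  qed
  then have "sorted (take j v @ drop (Suc j) u)"
    using su sv len by (intro sorted_take_append_drop) auto
  then show "take j v @ drop (Suc j) u \<in> row_words n p"
    using len sub jq \<open>q < p\<close> by (auto simp: row_words_def dest!: in_set_takeD in_set_dropD)
  have "u ! i \<le> v ! k" if "i \<le> j" "j \<le> k" "k < q" for i k
  proof -
    have "u ! i \<le> u ! j" using su that jq len \<open>q < p\<close> by (intro sorted_nth_mono) auto
    also have "\<dots> \<le> v ! j" using that by (intro jq) auto
    also have "\<dots> \<le> v ! k" using sv that len by (intro sorted_nth_mono) auto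
    finally show ?thesis .
  qed
  then have "sorted (take (Suc j) u @ drop j v)"
    using su sv len by (intro sorted_take_append_drop) auto
  then show "take (Suc j) u @ drop j v \<in> row_words n (Suc q)"
    using len sub jq \<open>q < p\<close> by (auto simp: row_words_def dest!: in_set_takeD in_set_dropD)
  have "u ! j \<le> u ! Suc j" using su len jq \<open>q < p\<close> by (intro sorted_nth_mono) auto
  then show "first_bad (take j v @ drop (Suc j) u) (take (Suc j) u @ drop j v) j"
    using len jq \<open>q < p\<close> by (auto simp: first_bad_def nth_append)
qed

lemma row_weight_swap:
  "row_weight xs (take a v @ drop b u) * row_weight xs (take b u @ drop a v) =
     row_weight xs u * row_weight xs v"
proof -
  have "row_weight xs w = row_weight xs (take c w) * row_weight xs (drop c w)" for w c
    unfolding prod_list.append[symmetric] map_append[symmetric] append_take_drop_id ..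
  from this[of u b] this[of v a] show ?thesis by (simp add: ac_simps)
qed

text \<open>Exchanging tails only redistributes the letters among the rows, so it is a bijection
  preserving weights.\<close>

lemma sum_bad_pairs:
  fixes xs :: "'a::comm_semiring_1 list"
  assumes "q < p"
  shows "(\<Sum>(u, v) | u \<in> row_words n p \<and> v \<in> row_words n (Suc q) \<and> \<not> (\<forall>j<Suc q. u ! j < v ! j).
            row_weight xs u * row_weight xs v) =
         (\<Sum>(u, v) \<in> row_words n (Suc p) \<times> row_words n q. row_weight xs u * row_weight xs v)"
proof -
  \<comment> \<open>The columns selected by \<open>THE\<close> are unique by
    \<open>first_bad_unique\<close> and \<open>first_good_unique\<close>, and they exist on the sets
    considered.\<close>
  define \<phi> where "\<phi> = (\<lambda>(u, v). let j = THE j. first_bad u v j in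
      (take (Suc j) v @ drop j u :: nat list, take j u @ drop (Suc j) v))"
  define \<psi> where "\<psi> = (\<lambda>(u, v). let j = THE j. first_good u v j in
      (take j v @ drop (Suc j) u :: nat list, take (Suc j) u @ drop j v))"
  have \<phi>: "\<phi> (u, v) = (take (Suc j) v @ drop j u, take j u @ drop (Suc j) v)" if "first_bad u v j" for u v j
  proof -
    have "(THE i. first_bad u v i) = j"
      using that by (rule the_equality) (rule first_bad_unique[OF _ that])
    then show ?thesis by (simp add: \<phi>_def Let_def)
  qed
  have \<psi>: "\<psi> (u, v) = (take j v @ drop (Suc j) u, take (Suc j) u @ drop j v)" if "first_good u v j" for u v j
  proof -
    have "(THE i. first_good u v i) = j"
      using that by (rule the_equality) (rule first_good_unique[OF _ that])
    then show ?thesis by (simp add: \<psi>_def Let_def)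
  qed
  show ?thesis
  proof (rule sum.reindex_bij_witness[of _ \<psi> \<phi>])
    fix x assume "x \<in> {(u, v). u \<in> row_words n p \<and> v \<in> row_words n (Suc q) \<and> \<not> (\<forall>j<Suc q. u ! j < v ! j)}"
    then obtain u v where x: "x = (u, v)" "u \<in> row_words n p" "v \<in> row_words n (Suc q)"
      "\<not> (\<forall>j<Suc q. u ! j < v ! j)" by auto
    then have len: "length u = p" "length v = Suc q" by (simp_all add: row_words_def)
    obtain j where j: "first_bad u v j" using ex_first_bad[of v u] x len by auto
    have jq: "j \<le> q" using j len by (simp add: first_bad_def)
    note s = swap_tails_bad[OF x(2,3) assms j]
    show "\<psi> (\<phi> x) = x"
      unfolding x \<phi>[OF j] \<psi>[OF s(3)] using len jq assms by simp
    show "\<phi> x \<in> row_words n (Suc p) \<times> row_words n q" unfolding x \<phi>[OF j] using s by simp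
    show "(case \<phi> x of (u, v) \<Rightarrow> row_weight xs u * row_weight xs v) = (case x of (u, v) \<Rightarrow> row_weight xs u * row_weight xs v)"
      unfolding x \<phi>[OF j] prod.case by (rule row_weight_swap)
  next
    fix x assume "x \<in> row_words n (Suc p) \<times> row_words n q"
    then obtain u v where x: "x = (u, v)" "u \<in> row_words n (Suc p)" "v \<in> row_words n q" by auto
    then have len: "length u = Suc p" "length v = q" by (simp_all add: row_words_def)
    obtain j where j: "first_good u v j" using ex_first_good by blast
    have jq: "j \<le> q" using j len by (simp add: first_good_def)
    note s = swap_tails_good[OF x(2,3) assms j]
    show "\<phi> (\<psi> x) = x"
      unfolding x \<psi>[OF j] \<phi>[OF s(3)] using len jq assms by simp
    have "\<not> (\<forall>i<Suc q. (take j v @ drop (Suc j) u) ! i < (take (Suc j) u @ drop j v) ! i)"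
    proof -
      have "(take (Suc j) u @ drop j v) ! j \<le> (take j v @ drop (Suc j) u) ! j"
        using s(3) by (simp only: first_bad_def)
      then show ?thesis using jq by (meson le_imp_less_Suc not_le)
    qed
    then show "\<psi> x \<in> {(u, v). u \<in> row_words n p \<and> v \<in> row_words n (Suc q) \<and> \<not> (\<forall>j<Suc q. u ! j < v ! j)}"
      unfolding x \<psi>[OF j] using s by simp
  qed
qed

lemma schur_two_rows:
  fixes xs :: "'a::comm_semiring_1 list"
  shows "schur [p, q] xs = (\<Sum>(u, v) | u \<in> row_words (length xs) p \<and> v \<in> row_words (length xs) q \<and>
      (\<forall>j<min p q. u ! j < v ! j). row_weight xs u * row_weight xs v)"
proof -
  let ?n = "length xs"
  have cell: "(i, j) \<in> cells [p, q] \<longleftrightarrow> i = 0 \<and> j < p \<or> i = 1 \<and> j < q" for i j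
    by (auto simp: cells_def nth_Cons' less_Suc_eq)
  have cells: "cells [p, q] = Pair 0 ` {..<p} \<union> Pair 1 ` {..<q}"
    by (auto simp: cell)
  \<comment> \<open>The value \<open>undefined\<close> off the cells is the one prescribed by the
    extensional function space \<open>\<rightarrow>\<^sub>E\<close>.\<close>
  define tab where "tab = (\<lambda>(u, v). \<lambda>(i, j). if (i, j) \<in> cells [p, q] then (if i = 0 then u else v) ! j else (undefined :: nat))"
  define words where "words T = (map (\<lambda>j. T (0, j)) [0..<p], map (\<lambda>j. T (1, j)) [0..<q])"
    for T :: "nat \<times> nat \<Rightarrow> nat"
  have W: "row_weight xs (map (\<lambda>j. T (i, j)) [0..<m]) = (\<Prod>j<m. xs ! T (i, j))" for T i m
    by (simp add: o_def prod.distinct_set_conv_list[symmetric] lessThan_atLeast0)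
  show ?thesis unfolding schur_def
  proof (rule sum.reindex_bij_witness[of _ tab words])
    fix T assume T: "T \<in> semistandard_tableaux [p, q] ?n"
    then have ext: "T \<in> cells [p, q] \<rightarrow>\<^sub>E {..<?n}"
      and row: "\<And>i j j'. j < j' \<Longrightarrow> (i, j) \<in> cells [p, q] \<Longrightarrow> (i, j') \<in> cells [p, q] \<Longrightarrow> T (i, j) \<le> T (i, j')"
      and col: "\<And>i i' j. i < i' \<Longrightarrow> (i, j) \<in> cells [p, q] \<Longrightarrow> (i', j) \<in> cells [p, q] \<Longrightarrow> T (i, j) < T (i', j)"
      unfolding semistandard_tableaux_def by blast+
    show "tab (words T) = T"
    proof
      fix c :: "nat \<times> nat"
      obtain i j where c: "c = (i, j)" by fastforce
      show "tab (words T) c = T c"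
        using PiE_arb[OF ext, of c] by (auto simp: tab_def words_def c cell)
    qed
    have "T (i, j) < ?n" if "(i, j) \<in> cells [p, q]" for i j using PiE_mem[OF ext that] by simp
    then have "words T \<in> row_words ?n p \<times> row_words ?n q"
      by (auto simp: words_def row_words_def sorted_iff_nth_mono_less cell intro!: row)
    moreover have "\<forall>j<min p q. fst (words T) ! j < snd (words T) ! j"
      by (auto simp: words_def cell intro!: col)
    ultimately show "words T \<in> {(u, v). u \<in> row_words ?n p \<and> v \<in> row_words ?n q \<and> (\<forall>j<min p q. u ! j < v ! j)}"
      by (simp add: words_def)
    have "(\<Prod>c\<in>cells [p, q]. xs ! T c) = (\<Prod>c\<in>Pair 0 ` {..<p}. xs ! T c) * (\<Prod>c\<in>Pair 1 ` {..<q}. xs ! T c)"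
      unfolding cells by (rule prod.union_disjoint) auto
    also have "\<dots> = (\<Prod>j<p. xs ! T (0, j)) * (\<Prod>j<q. xs ! T (1, j))"
      by (simp add: prod.reindex inj_on_def)
    finally show "(case words T of (u, v) \<Rightarrow> row_weight xs u * row_weight xs v) = (\<Prod>c\<in>cells [p, q]. xs ! T c)"
      unfolding words_def prod.case W by simp
  next
    fix x assume "x \<in> {(u, v). u \<in> row_words ?n p \<and> v \<in> row_words ?n q \<and> (\<forall>j<min p q. u ! j < v ! j)}"
    then obtain u v where x: "x = (u, v)" "u \<in> row_words ?n p" "v \<in> row_words ?n q"
      "\<And>j. j < p \<Longrightarrow> j < q \<Longrightarrow> u ! j < v ! j" by auto
    then have len: "length u = p" "length v = q" "sorted u" "sorted v"
      and ran: "\<And>j. j < p \<Longrightarrow> u ! j < ?n" "\<And>j. j < q \<Longrightarrow> v ! j < ?n"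
      by (auto simp: row_words_def subset_iff)
    show "words (tab x) = x"
      unfolding x words_def by (simp add: tab_def cell list_eq_iff_nth_eq len)
    have "tab x \<in> cells [p, q] \<rightarrow>\<^sub>E {..<?n}"
      unfolding x by (rule PiE_I) (auto simp: tab_def cell ran)
    moreover have "tab x (i, j) \<le> tab x (i, j')" if "j < j'" "(i, j) \<in> cells [p, q]" "(i, j') \<in> cells [p, q]" for i j j'
      using that len unfolding x by (auto simp: tab_def cell intro!: sorted_nth_mono)
    moreover have "tab x (i, j) < tab x (i', j)" if "i < i'" "(i, j) \<in> cells [p, q]" "(i', j) \<in> cells [p, q]" for i i' j
      using that x(4) unfolding x by (auto simp: tab_def cell)
    ultimately show "tab x \<in> semistandard_tableaux [p, q] ?n"
      unfolding semistandard_tableaux_def by blast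
  qed
qed

text \<open>The product on the right runs over all pairs of rows. The column strict pairs are the
  tableaux, the others are counted by \<open>sum_bad_pairs\<close>. The identity is additive because
  a semiring has no subtraction.\<close>

theorem jacobi_trudi_two_rows:
  fixes xs :: "'a::comm_semiring_1 list"
  assumes "q < p"
  shows "schur [p, Suc q] xs + complete_homogeneous (Suc p) xs * complete_homogeneous q xs =
     complete_homogeneous p xs * complete_homogeneous (Suc q) xs"
proof -
  let ?n = "length xs"
  let ?A = "row_words ?n p \<times> row_words ?n (Suc q)"
  let ?good = "{(u, v). u \<in> row_words ?n p \<and> v \<in> row_words ?n (Suc q) \<and> (\<forall>j<Suc q. u ! j < v ! j)}"
  let ?bad = "{(u, v). u \<in> row_words ?n p \<and> v \<in> row_words ?n (Suc q) \<and> \<not> (\<forall>j<Suc q. u ! j < v ! j)}"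
  let ?f = "\<lambda>(u, v). row_weight xs u * row_weight xs v"
  have fin: "finite ?A" by simp
  have sub: "?good \<subseteq> ?A" "?bad \<subseteq> ?A" by auto
  have fin': "finite ?good" "finite ?bad" using sub fin by (meson finite_subset)+
  have "complete_homogeneous p xs * complete_homogeneous (Suc q) xs = sum ?f ?A"
    by (simp add: complete_homogeneous_row_words sum_product sum.cartesian_product)
  also have "?A = ?good \<union> ?bad" by blast
  also have "sum ?f (?good \<union> ?bad) = sum ?f ?good + sum ?f ?bad"
    using fin' by (rule sum.union_disjoint) blast
  also have "sum ?f ?good = schur [p, Suc q] xs"
    using assms by (simp add: schur_two_rows min_absorb2)
  also have "sum ?f ?bad = complete_homogeneous (Suc p) xs * complete_homogeneous q xs"
    unfolding sum_bad_pairs[OF assms]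
    by (simp add: complete_homogeneous_row_words sum_product sum.cartesian_product)
  finally show ?thesis by simp
qed

lemma schur_one_row: "schur [p, 0] xs = complete_homogeneous p xs"
proof -
  have "{(u, v). u \<in> row_words (length xs) p \<and> v \<in> row_words (length xs) 0 \<and> (\<forall>j<min p 0. u ! j < v ! j)} =
      (\<lambda>u. (u, [])) ` row_words (length xs) p"
    by (auto simp: row_words_def)
  then show ?thesis
    unfolding schur_two_rows by (simp add: sum.reindex inj_on_def complete_homogeneous_row_words)
qed

section \<open>Values at roots of unity\<close>

text \<open>The Jacobi-Trudi identity as a difference of consecutive \<open>H k l\<close>, ready for
  telescoping. The conditional makes \<open>H k (-1)\<close> zero, which the truncated
  \<open>l - 1\<close> would not do.\<close>

lemma schur_two_rows_diff:
  fixes xs :: "'a::comm_ring_1 list"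
  defines "H \<equiv> \<lambda>k l. complete_homogeneous l xs * complete_homogeneous (k - l) xs"
  assumes "2 * l \<le> k"
  shows "schur [k - l, l] xs = H k l - (if l = 0 then 0 else H k (l - 1))"
proof (cases l)
  case 0
  then show ?thesis by (simp add: H_def schur_one_row)
next
  case (Suc q)
  have "Suc (k - Suc q) = k - q" using assms(2) Suc by simp
  moreover have "q < k - Suc q" using assms(2) Suc by simp
  ultimately have "schur [k - l, l] xs + H k q = H k l"
    using jacobi_trudi_two_rows[of q "k - Suc q" xs] by (simp add: H_def Suc mult.commute)
  then show ?thesis using Suc by (simp add: eq_diff_eq)
qed

text \<open>Summation by parts: the weight \<open>complete_homogeneous (k - 2 * l) [1, 1]\<close> is
  \<open>k - 2 * l + 1\<close> and drops by \<open>2\<close> at each step, so each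
  \<open>H l\<close> before the last gets coefficient \<open>2\<close>. The symmetry
  \<open>H (k - l) = H l\<close> turns this into the sum over all \<open>j \<le> k\<close>.\<close>

lemma sum_schur_homogeneous_1:
  fixes xs :: "'a::comm_ring_1 list"
  shows "(\<Sum>l = 0..k div 2. schur [k - l, l] xs * complete_homogeneous (k - 2 * l) [1, 1]) =
     (\<Sum>j\<le>k. complete_homogeneous j xs * complete_homogeneous (k - j) xs)"
proof -
  define H where "H l = complete_homogeneous l xs * complete_homogeneous (k - l) xs" for l
  have abel: "(\<Sum>l = 0..L. schur [k - l, l] xs * of_nat (k - 2 * l + 1)) =
      of_nat (k - 2 * L + 1) * H L + 2 * (\<Sum>l<L. H l)" if "2 * L \<le> k" for L
    using that
  proof (induction L)
    case 0
    then show ?case using schur_two_rows_diff[of 0 k xs] by (simp add: H_def mult.commute)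
  next
    case (Suc L)
    then obtain m where m: "k = 2 * Suc L + m" using le_Suc_ex by blast
    have s: "schur [k - Suc L, Suc L] xs = H (Suc L) - H L"
      using schur_two_rows_diff[OF Suc.prems, of xs] by (simp add: H_def)
    have "(\<Sum>l = 0..Suc L. schur [k - l, l] xs * of_nat (k - 2 * l + 1)) =
        of_nat (k - 2 * L + 1) * H L + 2 * (\<Sum>l<L. H l) + (H (Suc L) - H L) * of_nat (k - 2 * Suc L + 1)"
      using Suc s by simp
    also have "k - 2 * L + 1 = k - 2 * Suc L + 1 + 2" using m by simp
    finally show ?case by (simp add: algebra_simps)
  qed
  have sym: "H (k - l) = H l" if "l \<le> k" for l using that by (simp add: H_def mult.commute)
  define L where "L = k div 2"
  have "(\<Sum>l = 0..L. schur [k - l, l] xs * complete_homogeneous (k - 2 * l) [1, 1]) =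
      of_nat (k - 2 * L + 1) * H L + 2 * (\<Sum>l<L. H l)"
    using abel[of L] by (simp add: L_def complete_homogeneous_1_1)
  also have "\<dots> = (\<Sum>j\<le>k. H j)"
  proof -
    have refl: "(\<Sum>j\<in>{k - L<..k}. H j) = (\<Sum>l<L. H l)"
      by (rule sum.reindex_bij_witness[of _ "\<lambda>l. k - l" "\<lambda>l. k - l"]) (use sym in \<open>auto simp: L_def\<close>)
    have "{..k} = {..<L} \<union> {L..k - L} \<union> {k - L<..k}" by (auto simp: L_def)
    then have "(\<Sum>j\<le>k. H j) = (\<Sum>l<L. H l) + (\<Sum>j = L..k - L. H j) + (\<Sum>j\<in>{k - L<..k}. H j)"
      by (simp only:) (subst sum.union_disjoint; (subst sum.union_disjoint)?; auto simp: L_def)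
    \<comment> \<open>The middle block is a single term for even \<open>k\<close> and two equal
      terms for odd \<open>k\<close>.\<close>
    moreover have "(\<Sum>j = L..k - L. H j) = of_nat (k - 2 * L + 1) * H L"
    proof (cases "even k")
      case True
      then have "k - L = L" "k - 2 * L = 0" by (auto simp: L_def)
      then show ?thesis by simp
    next
      case False
      then have k: "k - L = Suc L" "k - 2 * L = 1" by (auto simp: L_def elim!: oddE)
      moreover have "H (Suc L) = H L" using sym[of L] k by (simp add: L_def)
      ultimately show ?thesis by (simp add: algebra_simps)
    qed
    ultimately show ?thesis unfolding refl by (simp add: algebra_simps)
  qed
  finally show ?thesis by (simp add: L_def H_def)
qed

text \<open>All indices \<open>k - 2 * l\<close> have the parity of \<open>k\<close>, so the weights
  are all \<open>1\<close> or all \<open>0\<close>. In the first case the differences telescope to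
  the middle product.\<close>

lemma sum_schur_homogeneous_m1:
  fixes xs :: "'a::comm_ring_1 list"
  shows "(\<Sum>l = 0..k div 2. schur [k - l, l] xs * complete_homogeneous (k - 2 * l) [1, - 1]) =
     (if even k then (complete_homogeneous (k div 2) xs)\<^sup>2 else 0)"
proof (cases "even k")
  case True
  define H where "H l = complete_homogeneous l xs * complete_homogeneous (k - l) xs" for l
  have tele: "(\<Sum>l = 0..L. schur [k - l, l] xs) = H L" if "2 * L \<le> k" for L
    using that
  proof (induction L)
    case 0
    then show ?case using schur_two_rows_diff[of 0 k xs] by (simp add: H_def)
  next
    case (Suc L)
    have s: "schur [k - Suc L, Suc L] xs = H (Suc L) - H L"
      using schur_two_rows_diff[OF Suc.prems, of xs] by (simp add: H_def)
    then show ?case using Suc by simp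
  qed
  have "(\<Sum>l = 0..k div 2. schur [k - l, l] xs * complete_homogeneous (k - 2 * l) [1, - 1]) =
      (\<Sum>l = 0..k div 2. schur [k - l, l] xs)"
    using True by (intro sum.cong) (auto simp: complete_homogeneous_1_m1)
  also have "\<dots> = H (k div 2)" by (rule tele) simp
  also have "k - k div 2 = k div 2" using True by (auto elim!: evenE)
  then have "H (k div 2) = (complete_homogeneous (k div 2) xs)\<^sup>2"
    by (simp add: H_def power2_eq_square)
  finally show ?thesis using True by simp
next
  case False
  then show ?thesis by (auto simp: complete_homogeneous_1_m1 intro!: sum.neutral)
qed

text \<open>The evaluation occurring in \<open>exhibits_CSP\<close>, named so that it can be used as
  a semiring homomorphism and pushed into the symmetric polynomials.\<close>

definition eval_nat_poly :: "complex \<Rightarrow> nat poly \<Rightarrow> complex" where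
  "eval_nat_poly z p = poly (map_poly of_nat p) z"

lemma eval_nat_poly_add: "eval_nat_poly z (p + q) = eval_nat_poly z p + eval_nat_poly z q"
proof -
  have "map_poly of_nat (p + q) = (map_poly of_nat p + map_poly of_nat q :: complex poly)"
    by (rule poly_eqI) (simp add: coeff_map_poly)
  then show ?thesis by (simp add: eval_nat_poly_def)
qed

lemma eval_nat_poly_mult: "eval_nat_poly z (p * q) = eval_nat_poly z p * eval_nat_poly z q"
proof -
  have "map_poly of_nat (p * q) = (map_poly of_nat p * map_poly of_nat q :: complex poly)"
    by (rule poly_eqI) (simp add: coeff_map_poly coeff_mult)
  then show ?thesis by (simp add: eval_nat_poly_def)
qed

lemma eval_nat_poly_0 [simp]: "eval_nat_poly z 0 = 0"
  and eval_nat_poly_1 [simp]: "eval_nat_poly z 1 = 1"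
  and eval_nat_poly_X [simp]: "eval_nat_poly z [:0, 1:] = z"
  by (simp_all add: eval_nat_poly_def map_poly_pCons)

lemma eval_nat_poly_sum: "eval_nat_poly z (\<Sum>x\<in>A. f x) = (\<Sum>x\<in>A. eval_nat_poly z (f x))"
  by (induction A rule: infinite_finite_induct) (simp_all add: eval_nat_poly_add)

lemma eval_nat_poly_prod: "eval_nat_poly z (\<Prod>x\<in>A. f x) = (\<Prod>x\<in>A. eval_nat_poly z (f x))"
  by (induction A rule: infinite_finite_induct) (simp_all add: eval_nat_poly_mult)

lemma eval_nat_poly_power: "eval_nat_poly z (p ^ m) = eval_nat_poly z p ^ m"
  by (induction m) (simp_all add: eval_nat_poly_mult)

lemma eval_nat_poly_schur: "eval_nat_poly z (schur lam xs) = schur lam (map (eval_nat_poly z) xs)"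
  unfolding schur_def eval_nat_poly_sum eval_nat_poly_prod length_map
  by (intro sum.cong prod.cong refl nth_map[symmetric]) (auto simp: semistandard_tableaux_def dest: PiE_mem)

lemma eval_nat_poly_complete_homogeneous:
  "eval_nat_poly z (complete_homogeneous m xs) = complete_homogeneous m (map (eval_nat_poly z) xs)"
proof -
  have "eval_nat_poly z (row_weight xs is) = row_weight (map (eval_nat_poly z) xs) is"
    if "set is \<subseteq> {..<length xs}" for "is"
    using that by (induction "is") (simp_all add: eval_nat_poly_mult)
  then show ?thesis
    unfolding complete_homogeneous_row_words eval_nat_poly_sum length_map
    by (intro sum.cong) (auto simp: row_words_def)
qed

lemma eval_D_polynomial:
  fixes z :: complex
  shows "poly (map_poly of_nat (\<Sum>l = 0..k div 2.
      schur [k - l, l] (map (\<lambda>i. [:0, 1:] ^ (2 * i)) [0..<n]) *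
      complete_homogeneous (k - 2 * l) [1, [:0, 1:] ^ n])) z =
   (\<Sum>l = 0..k div 2. schur [k - l, l] (map (\<lambda>i. (z\<^sup>2) ^ i) [0..<n]) *
      complete_homogeneous (k - 2 * l) [1, z ^ n])"
  unfolding eval_nat_poly_def[symmetric] eval_nat_poly_sum eval_nat_poly_mult
    eval_nat_poly_schur eval_nat_poly_complete_homogeneous
  by (simp add: o_def eval_nat_poly_power power_mult del: One_nat_def)

section \<open>The polynomial at powers of a primitive root of unity\<close>

lemma primitive_root_power_eq_1_iff:
  assumes "primitive_root_of_unity m \<zeta>"
  shows "\<zeta> ^ j = 1 \<longleftrightarrow> m dvd j"
proof
  have m: "m > 0" "\<zeta> ^ m = 1" "\<And>j. 0 < j \<Longrightarrow> j < m \<Longrightarrow> \<zeta> ^ j \<noteq> 1"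
    using assms by (auto simp: primitive_root_of_unity_def)
  have "\<zeta> ^ j = (\<zeta> ^ m) ^ (j div m) * \<zeta> ^ (j mod m)"
    by (simp flip: power_mult power_add)
  then have j: "\<zeta> ^ j = \<zeta> ^ (j mod m)" using m by simp
  show "m dvd j" if "\<zeta> ^ j = 1"
  proof -
    have "\<not> 0 < j mod m" using m(3)[of "j mod m"] m(1) j that by auto
    then show ?thesis by (simp add: mod_eq_0_iff_dvd)
  qed
  show "\<zeta> ^ j = 1" if "m dvd j" using that m by (auto simp: power_mult)
qed

text \<open>The square of \<open>\<zeta> ^ d\<close> is a primitive root of unity of order
  \<open>n div g\<close>, so the \<open>n\<close> variables run \<open>g\<close> times through these
  roots. As \<open>\<zeta> ^ n = - 1\<close>, the parity of \<open>d\<close> decides between the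
  variables \<open>[1, 1]\<close> and \<open>[1, - 1]\<close>.\<close>

proposition D_polynomial_root_of_unity:
  fixes n d :: nat
  defines "g \<equiv> gcd n d"
  defines "N \<equiv> \<lambda>j. card {l. length l = g \<and> n div g * sum_list l = j}"
  assumes n: "n > 0" and \<zeta>: "primitive_root_of_unity (2 * n) \<zeta>"
  shows "poly (map_poly of_nat (\<Sum>l = 0..k div 2.
      schur [k - l, l] (map (\<lambda>i. [:0, 1:] ^ (2 * i)) [0..<n]) *
      complete_homogeneous (k - 2 * l) [1, [:0, 1:] ^ n])) (\<zeta> ^ d) =
    of_nat (if even d then \<Sum>j\<le>k. N j * N (k - j) else if even k then (N (k div 2))\<^sup>2 else 0)"
proof -
  have g: "g > 0" "g dvd n" "g dvd d" using n by (auto simp: g_def)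
  let ?w = "(\<zeta> ^ d)\<^sup>2" and ?r = "n div g"
  have "?w ^ i = 1 \<longleftrightarrow> ?r dvd i" for i
  proof -
    have "?w ^ i = \<zeta> ^ (2 * (d * i))" by (simp add: ac_simps flip: power_mult)
    then have "?w ^ i = 1 \<longleftrightarrow> n dvd d * i"
      by (simp add: primitive_root_power_eq_1_iff[OF \<zeta>])
    also have "n = ?r * g" using g by simp
    also have "d * i = d div g * i * g"
      using g by (metis dvd_div_mult_self mult.assoc mult.commute)
    also have "?r * g dvd d div g * i * g \<longleftrightarrow> ?r dvd d div g * i"
      using g by (intro dvd_times_right_cancel_iff) simp
    also have "\<dots> \<longleftrightarrow> ?r dvd i"
    proof (rule coprime_dvd_mult_right_iff)
      show "coprime ?r (d div g)" unfolding g_def using n by (intro div_gcd_coprime) simp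
    qed
    finally show ?thesis .
  qed
  then have "complete_homogeneous j (map (\<lambda>i. ?w ^ i) [0..<g * ?r]) = of_nat (N j)" for j
    unfolding N_def using g n by (intro complete_homogeneous_roots_of_unity) (auto simp: div_greater_zero_iff dvd_imp_le)
  then have h: "complete_homogeneous j (map (\<lambda>i. ?w ^ i) [0..<n]) = of_nat (N j)" for j
    using g by simp
  have "\<zeta> ^ n = - 1"
  proof -
    have "(\<zeta> ^ n)\<^sup>2 = 1" "\<zeta> ^ n \<noteq> 1"
      using primitive_root_power_eq_1_iff[OF \<zeta>, of "n * 2"] primitive_root_power_eq_1_iff[OF \<zeta>, of n] n
      by (auto simp: power_mult dest: dvd_imp_le)
    then show ?thesis by (simp add: power2_eq_1_iff)
  qed
  then have zn: "(\<zeta> ^ d) ^ n = (- 1) ^ d"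
    by (metis mult.commute power_mult)
  show ?thesis
  proof (cases "even d")
    case True
    then show ?thesis
      unfolding eval_D_polynomial zn by (simp add: sum_schur_homogeneous_1 h)
  next
    case False
    then show ?thesis
      unfolding eval_D_polynomial zn by (simp add: sum_schur_homogeneous_m1 h)
  qed
qed

section \<open>Fixed points and cyclic sieving\<close>

lemma D_rotation_funpow:
  "(D_rotation n ^^ d) f = f \<circ> (inv_into UNIV (rot_dedge n)) ^^ d"
proof (induction d)
  case (Suc d)
  have "(D_rotation n ^^ Suc d) f = f \<circ> ((inv_into UNIV (rot_dedge n)) ^^ d \<circ> inv_into UNIV (rot_dedge n))"
    by (simp only: funpow.simps comp_apply[of "D_rotation n"] Suc D_rotation_def comp_assoc)
  then show ?case by (simp only: funpow_Suc_right)
qed simp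

text \<open>With the inverse written as a positive power, closure under D-rotation follows from
  closure under composition with \<open>rot_dedge n\<close>.\<close>

lemma inv_rot_dedge:
  assumes n: "n > 0"
  shows "inv_into UNIV (rot_dedge n) = rot_dedge n ^^ (2 * n - 1)"
proof -
  have m: "2 * n = Suc (2 * n - 1)" using n by simp
  have id: "rot_dedge n ^^ Suc (2 * n - 1) = id" using rot_dedge_funpow_2n[OF n] m by simp
  show ?thesis
  proof (rule inv_unique_comp)
    show "rot_dedge n \<circ> rot_dedge n ^^ (2 * n - 1) = id" using id by (simp only: funpow.simps)
    show "rot_dedge n ^^ (2 * n - 1) \<circ> rot_dedge n = id" using id by (simp only: funpow_Suc_right)
  qed
qed

text \<open>Invariance under a bijection is the same as invariance under its inverse, which removes
  the inverse from the definition of \<open>D_rotation\<close>.\<close>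

lemma D_rotation_fixed_iff:
  assumes n: "n > 0"
  shows "(D_rotation n ^^ d) f = f \<longleftrightarrow> f \<circ> rot_dedge n ^^ d = f"
proof -
  let ?R = "rot_dedge n ^^ d" and ?S = "(inv_into UNIV (rot_dedge n)) ^^ d"
  have SR: "?S \<circ> ?R = id" "?R \<circ> ?S = id"
    using inv_fn_o_fn_is_id[OF bij_rot_dedge[OF n], of d] fn_o_inv_fn_is_id[OF bij_rot_dedge[OF n], of d]
    by (simp_all add: id_def)
  show ?thesis unfolding D_rotation_funpow
  proof
    assume *: "f \<circ> ?S = f"
    have "f = f \<circ> (?S \<circ> ?R)" by (simp only: SR comp_id)
    also have "\<dots> = f \<circ> ?R" by (simp only: comp_assoc[symmetric] *)
    finally show "f \<circ> ?R = f" ..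
  next
    assume *: "f \<circ> ?R = f"
    have "f = f \<circ> (?R \<circ> ?S)" by (simp only: SR comp_id)
    also have "\<dots> = f \<circ> ?S" by (simp only: comp_assoc[symmetric] *)
    finally show "f \<circ> ?S = f" ..
  qed
qed

lemma D_rotation_funpow_2n: "n > 0 \<Longrightarrow> (D_rotation n ^^ (2 * n)) f = f"
  by (simp add: D_rotation_fixed_iff rot_dedge_funpow_2n)

lemma D_rotation_funpow_mod: "n > 0 \<Longrightarrow> (D_rotation n ^^ (d mod (2 * n))) f = (D_rotation n ^^ d) f"
  by (rule funpow_mod_eq) (rule D_rotation_funpow_2n)

text \<open>An injective self-map of a finite set is onto, so \<open>rot_dedge n\<close> permutes
  the pairs and permutes the diameters, and reindexing leaves both sums unchanged.\<close>

lemma comp_rot_dedge_in_D_multidissections: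
  assumes n: "n > 0" and f: "f \<in> D_multidissections n k"
  shows "f \<circ> rot_dedge n \<in> D_multidissections n k"
proof -
  let ?R = "rot_dedge n"
  have inj: "inj ?R" using bij_rot_dedge[OF n] by (rule bij_is_inj)
  have "?R ` cs_dedges n \<subseteq> cs_dedges n"
  proof (rule image_subsetI)
    fix D assume "D \<in> cs_dedges n"
    then obtain i j where "D = cs_pair n i j" "i < j" "j < i + int n" by (auto simp: cs_dedges_eq[OF n])
    then have "?R D = cs_pair n (i + 1) (j + 1)" "i + 1 < j + 1" "j + 1 < i + 1 + int n"
      by (simp_all add: rot_dedge_eq turn_cs_pair)
    then show "?R D \<in> cs_dedges n" unfolding cs_dedges_eq[OF n] by blast
  qed
  then have cs: "?R ` cs_dedges n = cs_dedges n"
    using inj by (intro endo_inj_surj) (auto intro: inj_on_subset)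
  have "?R ` diam_dedges n \<subseteq> diam_dedges n"
  proof (rule image_subsetI)
    fix D assume "D \<in> diam_dedges n"
    then obtain col i where "D = diam n col i" by (auto simp: diam_dedges_eq[OF n])
    then have "?R D = diam n (switch col) (i + 1)" by (simp add: rot_dedge_eq turn_diam)
    then show "?R D \<in> diam_dedges n" unfolding diam_dedges_eq[OF n] by blast
  qed
  then have di: "?R ` diam_dedges n = diam_dedges n"
    using inj by (intro endo_inj_surj) (auto intro: inj_on_subset)
  have "noncrossing n (f \<circ> recolour \<circ> turn n ^^ 1)"
    using f unfolding D_multidissections_eq[OF n]
    by (intro noncrossing_comp_turn[OF n] noncrossing_comp_recolour[OF n]) simp
  then have nc: "noncrossing n (f \<circ> ?R)" by (simp add: rot_dedge_eq comp_assoc)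
  have "(\<Sum>D \<in> cs_dedges n. 2 * (f \<circ> ?R) D) = (\<Sum>D \<in> cs_dedges n. 2 * f D)"
    using sum.reindex_bij_betw[of ?R "cs_dedges n" "cs_dedges n" "\<lambda>D. 2 * f D"] cs inj
    by (simp add: bij_betw_def inj_on_subset)
  moreover have "(\<Sum>D \<in> diam_dedges n. (f \<circ> ?R) D) = (\<Sum>D \<in> diam_dedges n. f D)"
    using sum.reindex_bij_betw[of ?R "diam_dedges n" "diam_dedges n" f] di inj
    by (simp add: bij_betw_def inj_on_subset)
  ultimately show ?thesis
    using f nc unfolding D_multidissections_def noncrossing_def by simp
qed

lemma D_rotation_in_D_multidissections:
  assumes n: "n > 0" and f: "f \<in> D_multidissections n k"
  shows "(D_rotation n ^^ d) f \<in> D_multidissections n k"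
proof -
  have "f \<circ> rot_dedge n ^^ e \<in> D_multidissections n k" for e
  proof (induction e)
    case (Suc e)
    have "f \<circ> rot_dedge n ^^ Suc e = (f \<circ> rot_dedge n ^^ e) \<circ> rot_dedge n"
      by (simp only: funpow_Suc_right comp_assoc)
    then show ?case by (simp only: comp_rot_dedge_in_D_multidissections[OF n Suc])
  qed (use f in simp)
  then show ?thesis
    unfolding D_rotation_funpow inv_rot_dedge[OF n] funpow_mult by blast
qed

lemma finite_D_multidissections: "finite (D_multidissections n k)"
proof (rule finite_subset)
  show "D_multidissections n k \<subseteq>
      {f. \<forall>D. (D \<in> dedges n \<longrightarrow> f D \<in> {..k}) \<and> (D \<notin> dedges n \<longrightarrow> f D = 0)}"
  proof
    fix f assume f: "f \<in> D_multidissections n k"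
    have "f D \<le> k" if "D \<in> dedges n" for D
    proof (cases "D \<in> cs_dedges n")
      case True
      then have "2 * f D \<le> (\<Sum>D \<in> cs_dedges n. 2 * f D)" by (intro member_le_sum) auto
      then show ?thesis using f by (simp add: D_multidissections_def)
    next
      case False
      then have "D \<in> diam_dedges n" using that by (simp add: dedges_def)
      then have "f D \<le> (\<Sum>D \<in> diam_dedges n. f D)" by (intro member_le_sum) auto
      then show ?thesis using f by (simp add: D_multidissections_def)
    qed
    then show "f \<in> {f. \<forall>D. (D \<in> dedges n \<longrightarrow> f D \<in> {..k}) \<and> (D \<notin> dedges n \<longrightarrow> f D = 0)}"
      using f by (simp add: D_multidissections_def)
  qed
qed (rule finite_set_of_finite_funs; simp)

lemma group_action_D_action:
  assumes n: "n > 0"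
  shows "group_action (integer_mod_group (2 * n)) (D_multidissections n k) (D_action n k)"
proof -
  let ?G = "integer_mod_group (2 * n)" and ?X = "D_multidissections n k"
  have Bij: "D_action n k j \<in> Bij ?X" for j
  proof -
    let ?d = "nat j"
    have "bij_betw (D_rotation n ^^ ?d) ?X ?X"
    \<comment> \<open>The inverse of rotation by \<open>?d\<close> steps consists of
      \<open>?d\<close> full turns less \<open>?d\<close> steps.\<close>
    proof (rule bij_betw_byWitness[where f' = "D_rotation n ^^ (2 * n * ?d - ?d)"])
      have inv: "(D_rotation n ^^ (2 * n * ?d)) f = f" for f
        using D_rotation_funpow_mod[OF n, of "2 * n * ?d" f] by simp
      have "2 * n * ?d - ?d + ?d = 2 * n * ?d" using n by simp
      then show "\<forall>f\<in>?X. (D_rotation n ^^ (2 * n * ?d - ?d)) ((D_rotation n ^^ ?d) f) = f"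
        using inv by (metis funpow_add o_apply)
      have "?d + (2 * n * ?d - ?d) = 2 * n * ?d" using n by simp
      then show "\<forall>f\<in>?X. (D_rotation n ^^ ?d) ((D_rotation n ^^ (2 * n * ?d - ?d)) f) = f"
        using inv by (metis funpow_add o_apply)
    qed (use D_rotation_in_D_multidissections[OF n] in blast)+
    then show ?thesis by (simp add: Bij_def D_action_def bij_betw_restrict_eq)
  qed
  have "D_action n k \<in> hom ?G (BijGroup ?X)"
  proof (rule homI)
    show "D_action n k x \<in> carrier (BijGroup ?X)" for x using Bij by (simp add: BijGroup_def)
  next
    fix x y assume xy: "x \<in> carrier ?G" "y \<in> carrier ?G"
    have nat: "nat ((x + y) mod int (2 * n)) = (nat x + nat y) mod (2 * n)"
      using xy n by (auto simp: carrier_integer_mod_group nat_mod_distrib nat_add_distrib nat_mult_distrib)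
    have "D_action n k (x \<otimes>\<^bsub>?G\<^esub> y) = compose ?X (D_action n k x) (D_action n k y)"
    proof
      fix f
      show "D_action n k (x \<otimes>\<^bsub>?G\<^esub> y) f = compose ?X (D_action n k x) (D_action n k y) f"
        using D_rotation_in_D_multidissections[OF n]
        by (simp add: D_action_def compose_def nat D_rotation_funpow_mod[OF n] funpow_add del: of_nat_mult)
    qed
    then show "D_action n k (x \<otimes>\<^bsub>?G\<^esub> y) = D_action n k x \<otimes>\<^bsub>BijGroup ?X\<^esub> D_action n k y"
      using Bij by (simp add: BijGroup_def)
  qed
  then show ?thesis
    by (intro group_action.intro group_hom.intro group_BijGroup group_integer_mod_group)
      (simp add: group_hom_axioms_def)
qed

lemma ord_1_integer_mod_group:
  assumes "m > 1"
  shows "group.ord (integer_mod_group m) 1 = m"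
proof -
  have "(1 [^]\<^bsub>integer_mod_group m\<^esub> j = \<one>\<^bsub>integer_mod_group m\<^esub>) = (m dvd j)" for j :: nat
    by (simp add: mod_eq_0_iff_dvd flip: zmod_int)
  then show ?thesis
    using group.ord_unique[OF group_integer_mod_group, of 1 m m] assms by simp
qed

lemma generate_1_integer_mod_group:
  assumes "m > 1"
  shows "generate (integer_mod_group m) {1} = carrier (integer_mod_group m)"
proof -
  have "generate (integer_mod_group m) {1} = {1 [^]\<^bsub>integer_mod_group m\<^esub> (k :: int) | k. k \<in> UNIV}"
    using assms by (intro group.generate_pow) simp_all
  also have "\<dots> = range (\<lambda>k. k mod int m)" by (auto simp: int_pow_integer_mod_group)
  also have "\<dots> = {0..<int m}"
  proof (intro equalityI subsetI)
    fix x assume "x \<in> {0..<int m}"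
    then have "x = x mod int m" by simp
    then show "x \<in> range (\<lambda>k. k mod int m)" by blast
  qed (use assms in auto)
  finally show ?thesis using assms by (simp add: carrier_integer_mod_group)
qed

section \<open>Sequences with two periods\<close>

lemma periodic_mult:
  fixes a :: "int \<Rightarrow> 'a"
  assumes "\<And>m. a (m + p) = a m"
  shows "a (m + t * p) = a m"
proof -
  have nat: "a (m + int s * p) = a m" for s m
  proof (induction s)
    case (Suc s)
    have "m + int (Suc s) * p = (m + int s * p) + p" by (simp add: algebra_simps)
    then show ?case using Suc assms by metis
  qed simp
  show ?thesis
  proof (cases "t \<ge> 0")
    case True
    then show ?thesis using nat[of m "nat t"] by simp
  next
    case False
    then show ?thesis using nat[of "m + t * p" "nat (- t)"] by simp
  qed
qed

text \<open>The possible degree sequences of fixed points: period \<open>n\<close> comes from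
  central symmetry, period \<open>d\<close> from invariance. The sum is over \<open>n\<close> steps
  also when the least period is smaller.\<close>

definition biperiodic :: "nat \<Rightarrow> nat \<Rightarrow> nat \<Rightarrow> (int \<Rightarrow> nat) set" where
  "biperiodic n d j = {a. (\<forall>m. a (m + int n) = a m) \<and> (\<forall>m. a (m + int d) = a m) \<and>
     (\<Sum>m\<in>{0..<int n}. a m) = j}"

text \<open>By Bezout's identity \<open>gcd n d\<close> is an integer combination of the two
  periods, hence itself a period.\<close>

lemma biperiodic_mod_gcd:
  assumes "\<And>m. a (m + int n) = a m" "\<And>m. a (m + int d) = (a m :: 'a)"
  shows "a (m mod int (gcd n d)) = a m"
proof -
  obtain u v where uv: "u * int n + v * int d = int (gcd n d)"
    using bezout_int[of "int n" "int d"] by auto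
  have "a (m + int (gcd n d)) = a m" for m
  proof -
    have "a (m + int (gcd n d)) = a ((m + u * int n) + v * int d)" unfolding uv[symmetric] by (simp add: add.assoc)
    also have "\<dots> = a m" using periodic_mult[of a, OF assms(2)] periodic_mult[of a, OF assms(1)] by simp
    finally show ?thesis .
  qed
  then have "a (m mod int (gcd n d) + (m div int (gcd n d)) * int (gcd n d)) = a (m mod int (gcd n d))"
    by (rule periodic_mult)
  then show ?thesis by simp
qed

lemma sum_biperiodic:
  fixes a :: "int \<Rightarrow> nat"
  assumes a: "\<And>m. a (m mod int g) = a m" and n: "n = r * g" and g: "g > 0"
  shows "(\<Sum>m\<in>{0..<int n}. a m) = r * sum_list (map (\<lambda>i. a (int i)) [0..<g])"
proof -
  have "(\<Sum>m\<in>{0..<int n}. a m) = (\<Sum>i<n. a (int i))"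
    by (rule sum.reindex_bij_witness[of _ int nat]) auto
  also have "\<dots> = (\<Sum>i<r * g. a (int i))" by (simp only: n)
  also have "\<dots> = (\<Sum>q<r. \<Sum>i\<in>{q * g..<q * g + g}. a (int i))"
    by (rule sum.nat_group[symmetric])
  also have "\<dots> = (\<Sum>q<r. \<Sum>i<g. a (int i))"
  proof (rule sum.cong)
    fix q
    have "(\<Sum>i\<in>{q * g..<q * g + g}. a (int i)) = (\<Sum>i\<in>{0..<g}. a (int (i + q * g)))"
      using sum.shift_bounds_nat_ivl[of "\<lambda>i. a (int i)" 0 "q * g" g] by (simp add: add.commute)
    also have "\<dots> = (\<Sum>i\<in>{0..<g}. a (int i))"
    proof (rule sum.cong)
      fix i
      have "int (i + q * g) mod int g = int i mod int g" by simp
      then show "a (int (i + q * g)) = a (int i)" using a by metis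
    qed simp
    finally show "(\<Sum>i\<in>{q * g..<q * g + g}. a (int i)) = (\<Sum>i<g. a (int i))"
      by (simp add: lessThan_atLeast0)
  qed simp
  also have "\<dots> = r * (\<Sum>i<g. a (int i))" by simp
  finally show ?thesis by (simp add: lessThan_atLeast0 sum.distinct_set_conv_list[symmetric])
qed

text \<open>A sequence with both periods is a block of length \<open>gcd n d\<close>, repeated
  \<open>n div gcd n d\<close> times in the range of summation.\<close>

lemma bij_betw_biperiodic:
  assumes n: "n > 0"
  shows "bij_betw (\<lambda>a. map (\<lambda>i. a (int i)) [0..<gcd n d]) (biperiodic n d j)
           {l. length l = gcd n d \<and> n div gcd n d * sum_list l = j}"
proof (rule bij_betw_byWitness[where f' = "\<lambda>l m. l ! nat (m mod int (gcd n d))"])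
  let ?g = "gcd n d"
  have g: "?g > 0" "n = n div ?g * ?g" using n by simp_all
  have lt: "nat (m mod int ?g) < ?g" for m
    using g(1) by (simp add: nat_less_iff)
  have per: "a (m mod int ?g) = a m" if "a \<in> biperiodic n d j" for a m
    using that by (intro biperiodic_mod_gcd) (auto simp: biperiodic_def)
  show "\<forall>a\<in>biperiodic n d j. (\<lambda>m. map (\<lambda>i. a (int i)) [0..<?g] ! nat (m mod int ?g)) = a"
  proof (intro ballI ext)
    fix a m assume "a \<in> biperiodic n d j"
    then show "map (\<lambda>i. a (int i)) [0..<?g] ! nat (m mod int ?g) = a m"
      using lt[of m] per[of a m] g(1) by simp
  qed
  have undo: "map (\<lambda>i. l ! nat (int i mod int ?g)) [0..<?g] = l" if "length l = ?g" for l :: "nat list"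
    using that by (intro nth_equalityI) (simp_all flip: zmod_int)
  then show "\<forall>l\<in>{l. length l = ?g \<and> n div ?g * sum_list l = j}.
      map (\<lambda>i. l ! nat (int i mod int ?g)) [0..<?g] = l" by blast
  show "(\<lambda>a. map (\<lambda>i. a (int i)) [0..<?g]) ` biperiodic n d j \<subseteq>
      {l. length l = ?g \<and> n div ?g * sum_list l = j}"
  proof (intro image_subsetI)
    fix a assume a: "a \<in> biperiodic n d j"
    then have "(\<Sum>m\<in>{0..<int n}. a m) = j" by (simp add: biperiodic_def)
    then show "map (\<lambda>i. a (int i)) [0..<?g] \<in> {l. length l = ?g \<and> n div ?g * sum_list l = j}"
      using sum_biperiodic[of a ?g n "n div ?g", OF per[OF a] g(2) g(1)] by simp
  qed
  show "(\<lambda>l m. l ! nat (m mod int ?g)) ` {l. length l = ?g \<and> n div ?g * sum_list l = j} \<subseteq> biperiodic n d j"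
  proof (intro image_subsetI)
    fix l :: "nat list" assume l: "l \<in> {l. length l = ?g \<and> n div ?g * sum_list l = j}"
    have "(m + int c) mod int ?g = m mod int ?g" if "?g dvd c" for m c
      using that by (auto simp: dvd_def)
    then have "(m + int n) mod int ?g = m mod int ?g" "(m + int d) mod int ?g = m mod int ?g" for m
      by simp_all
    moreover have "(\<Sum>m\<in>{0..<int n}. l ! nat (m mod int ?g)) = j"
      using sum_biperiodic[of "\<lambda>m. l ! nat (m mod int ?g)" ?g n "n div ?g", OF _ g(2) g(1)] l undo[of l]
      by simp
    ultimately show "(\<lambda>m. l ! nat (m mod int ?g)) \<in> biperiodic n d j"
      by (simp add: biperiodic_def)
  qed
qed

lemma finite_biperiodic:
  assumes n: "n > 0"
  shows "finite (biperiodic n d j)"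
proof -
  have "n div gcd n d > 0" using n by (simp add: div_greater_zero_iff dvd_imp_le)
  then show ?thesis
    using bij_betw_finite[OF bij_betw_biperiodic[OF n, of d j]] finite_lists_scaled_sum by blast
qed

text \<open>The bijection of \<open>ex1_noncrossing\<close> restricts to fixed points, since by
  \<open>comp_rot_dedge_eq_iff\<close> being fixed is a condition on degrees alone. For odd
  \<open>d\<close> the two sums are equal with total \<open>k\<close>, so each is
  \<open>k div 2\<close>, and there is no solution for odd \<open>k\<close>.\<close>

lemma bij_betw_fixed_multidissections:
  assumes n: "n > 0"
  shows "bij_betw (\<lambda>f. (outdeg n f, indeg n f))
     {f \<in> D_multidissections n k. f \<circ> rot_dedge n ^^ d = f}
     (if even d then \<Union>j\<le>k. biperiodic n d j \<times> biperiodic n d (k - j)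
      else if even k then biperiodic n d (k div 2) \<times> biperiodic n d (k div 2) else {})"
    (is "bij_betw ?\<Phi> ?F ?T")
proof -
  have T: "(a, b) \<in> ?T \<longleftrightarrow> (\<forall>m. a (m + int n) = a m) \<and> (\<forall>m. b (m + int n) = b m) \<and>
      (\<forall>m. a (m + int d) = a m) \<and> (\<forall>m. b (m + int d) = b m) \<and>
      (\<Sum>m\<in>{0..<int n}. a m) + (\<Sum>m\<in>{0..<int n}. b m) = k \<and>
      (odd d \<longrightarrow> (\<Sum>m\<in>{0..<int n}. a m) = (\<Sum>m\<in>{0..<int n}. b m))" for a b
    by (auto simp: biperiodic_def)
  have F: "f \<in> ?F \<longleftrightarrow> noncrossing n f \<and> ?\<Phi> f \<in> ?T" for f
  proof -
    have "outdeg n f (m + int n) = outdeg n f m" "indeg n f (m + int n) = indeg n f m" for m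
      using n by (auto intro: outdeg_mod_cong indeg_mod_cong)
    then show ?thesis
      unfolding T using comp_rot_dedge_eq_iff[OF n, of f d] by (auto simp: D_multidissections_eq[OF n])
  qed
  show ?thesis
  proof (rule bij_betw_imageI)
    show "inj_on ?\<Phi> ?F"
      using F noncrossing_eqI[OF n] by (intro inj_onI) blast
    show "?\<Phi> ` ?F = ?T"
    proof (intro equalityI subsetI)
      fix t assume t: "t \<in> ?T"
      obtain a b where ab: "t = (a, b)" by (cases t)
      have "\<exists>!f. noncrossing n f \<and> outdeg n f = a \<and> indeg n f = b"
      proof (rule ex1_noncrossing[OF n])
        fix i k assume "i mod int n = k mod int n"
        then obtain s where s: "k = i + s * int n" using mod_eq_imp_shift by blast
        show "a i = a k" "b i = b k"
          using t unfolding ab T s by (simp_all add: periodic_mult)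
      qed
      then obtain f where "noncrossing n f" "?\<Phi> f = t" using ab by auto
      then show "t \<in> ?\<Phi> ` ?F" using F t by (intro image_eqI[of _ _ f]) auto
    qed (use F in blast)
  qed
qed

lemma card_fixed_multidissections:
  fixes n d :: nat
  defines "N \<equiv> \<lambda>j. card {l. length l = gcd n d \<and> n div gcd n d * sum_list l = j}"
  assumes n: "n > 0"
  shows "card {f \<in> D_multidissections n k. f \<circ> rot_dedge n ^^ d = f} =
    (if even d then \<Sum>j\<le>k. N j * N (k - j) else if even k then (N (k div 2))\<^sup>2 else 0)"
proof -
  have N: "card (biperiodic n d j) = N j" for j
    unfolding N_def by (rule bij_betw_same_card[OF bij_betw_biperiodic[OF n]])
  have "card (\<Union>j\<le>k. biperiodic n d j \<times> biperiodic n d (k - j)) = (\<Sum>j\<le>k. N j * N (k - j))"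
  proof (subst card_UN_disjoint)
    show "\<forall>i\<in>{..k}. \<forall>j\<in>{..k}. i \<noteq> j \<longrightarrow>
        biperiodic n d i \<times> biperiodic n d (k - i) \<inter> biperiodic n d j \<times> biperiodic n d (k - j) = {}"
      by (auto simp: biperiodic_def)
  qed (simp_all add: finite_biperiodic[OF n] card_cartesian_product N)
  then show ?thesis
    using bij_betw_same_card[OF bij_betw_fixed_multidissections[OF n, of k d]]
    by (simp add: card_cartesian_product N power2_eq_square)
qed

text \<open>For every \<open>d\<close>, the number of fixed points and the value of the polynomial
  are the same expression in the numbers of lists \<open>l\<close> of length \<open>gcd n d\<close>
  with \<open>n div gcd n d * sum_list l = j\<close>.\<close>

theorem theorem4p6:
  fixes n k :: nat
  assumes "n \<ge> 2"
  shows "exhibits_CSP (D_multidissections n k) (integer_mod_group (2 * n)) 1 (D_action n k)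
           (\<Sum>l = 0..k div 2.
              schur [k - l, l] (map (\<lambda>i. [:0, 1:] ^ (2 * i)) [0..<n]) *
              complete_homogeneous (k - 2 * l) [1, [:0, 1:] ^ n])"
proof -
  let ?G = "integer_mod_group (2 * n)" and ?X = "D_multidissections n k"
  have n: "n > 0" and m: "2 * n > 1" using assms by auto
  have fixed: "card {f \<in> ?X. D_action n k (1 [^]\<^bsub>?G\<^esub> d) f = f} =
      card {f \<in> ?X. f \<circ> rot_dedge n ^^ d = f}" for d :: nat
  proof -
    \<comment> \<open>The group element is represented by \<open>d mod (2 * n)\<close>, which acts
      as \<open>d\<close> steps do because D-rotation has period \<open>2 * n\<close>.\<close>
    have "nat (1 [^]\<^bsub>?G\<^esub> d) = d mod (2 * n)" by (simp add: nat_mod_distrib nat_mult_distrib)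
    then show ?thesis
      by (intro arg_cong[where f = card])
        (auto simp: D_action_def D_rotation_funpow_mod[OF n] D_rotation_fixed_iff[OF n])
  qed
  show ?thesis
    unfolding exhibits_CSP_def ord_1_integer_mod_group[OF m]
  proof (intro conjI allI impI)
    show "finite ?X" by (rule finite_D_multidissections)
    show "finite (carrier ?G)" "1 \<in> carrier ?G" using m by (simp_all add: carrier_integer_mod_group)
    show "generate ?G {1} = carrier ?G" using m by (rule generate_1_integer_mod_group)
    show "group_action ?G ?X (D_action n k)" using n by (rule group_action_D_action)
  next
    fix \<zeta> and d :: nat
    assume \<zeta>: "primitive_root_of_unity (2 * n) \<zeta>"
    show "of_nat (card {x \<in> ?X. D_action n k (1 [^]\<^bsub>?G\<^esub> d) x = x}) =
      poly (map_poly of_nat (\<Sum>l = 0..k div 2.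
        schur [k - l, l] (map (\<lambda>i. [:0, 1:] ^ (2 * i)) [0..<n]) *
        complete_homogeneous (k - 2 * l) [1, [:0, 1:] ^ n])) (\<zeta> ^ d)"
      unfolding fixed card_fixed_multidissections[OF n] D_polynomial_root_of_unity[OF n \<zeta>] ..
  qed
qed

end
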